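(* For every real $k\ge 4$, we have $\mathrm{m}(P_k)=\mathrm{m}(Q_{k+2})$, where $$P_k(x,y)=(x^2+x+1)y^2+kx(x+1)y+x(x^2+x+1)$$ and $$Q_k(x,y)=(x^2+x+1)y^2+(x^4+kx^3+(2k-4)x^2+kx+1)y+x^2(x^2+x+1).$$
   Context: For a nonzero Laurent polynomial $F(x,y)\in\mathbb C[x^{\pm1},y^{\pm1}]$, its (logarithmic) Mahler measure is $$\mathrm{m}(F)=\frac1{(2\pi i)^2}\iint_{|x|=|y|=1}\log|F(x,y)|\,\frac{dx}{x}\,\frac{dy}{y}.$$ *)

theory Defs
  imports "HOL-Analysis.Analysis"
begin

definition mahler2 :: "(complex \<Rightarrow> complex \<Rightarrow> complex) \<Rightarrow> real" where
  "mahler2 F = (1 / (2 * pi)^2) *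
     (\<integral>st. indicator ({0..2*pi} \<times> {0..2*pi}) st *
        ln (cmod (F (cis (fst st)) (cis (snd st)))) \<partial>(lborel :: (real \<times> real) measure))"

definition P_poly :: "real \<Rightarrow> complex \<Rightarrow> complex \<Rightarrow> complex" where
  "P_poly k x y = (x^2 + x + 1) * y^2 + of_real k * x * (x + 1) * y + x * (x^2 + x + 1)"

definition Q_poly :: "real \<Rightarrow> complex \<Rightarrow> complex \<Rightarrow> complex" where
  "Q_poly k x y = (x^2 + x + 1) * y^2
     + (x^4 + of_real k * x^3 + (2 * of_real k - 4) * x^2 + of_real k * x + 1) * y
     + x^2 * (x^2 + x + 1)"

end

theory Submission
  imports Defs
begin

text \<open>For \<open>x = cis t\<close> put \<open>u = 2 + 2 cos t = \<bar>1 + x\<bar>\<^sup>2\<close>. After a rotation of \<open>y\<close>, both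
  polynomials have modulus \<open>\<bar>a (y\<^sup>2 + 1) + b y\<bar>\<close> with \<open>a = u - 1\<close> and \<open>b\<close> an affine function of
  \<open>k\<close>, so Jensen's formula turns each Mahler measure into a mean over \<open>t\<close>. The \<open>k\<close>-derivatives of
  the two means are complete elliptic integrals in \<open>u\<close>, and a Moebius transformation carries one into
  the other. Hence the difference of the Mahler measures is constant in \<open>k\<close>. As \<open>k \<rightarrow> \<infinity>\<close> both
  measures are \<open>ln k + o(1)\<close>, because \<open>ln u\<close> has mean zero; so the constant is zero.\<close>

section \<open>Jensen's formula for linear factors\<close>

text \<open>The means of the two polynomials do not agree pointwise in \<open>u\<close>; only the
  integrals of their \<open>k\<close>-derivatives do. The Moebius map is dictated by branch points.
  With the Jacobian of \<open>u = 2 + 2 cos t\<close> included, the integrand for \<open>P\<close>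
  is the inverse square root of a cubic with roots \<open>4\<close> and the two roots of
  \<open>k^2 u = 4 (u - 1)^2\<close>, hence also branched at infinity. The integrand for
  \<open>Q\<close> is the inverse square root of a quartic with roots \<open>4\<close>,
  \<open>4 - k\<close> and the two roots of \<open>t^2 + k t - 4\<close>. The map fixes
  \<open>4\<close>, sends \<open>4 - k\<close> to infinity and matches the remaining pairs.

  The derivatives blow up where two roots in \<open>y\<close> meet on the unit circle, so nothing is
  differentiated under the integral sign. Increments in \<open>k\<close> are integrals of the
  derivative, and Tonelli's theorem for nonnegative functions swaps the order of integration.

  The bound \<open>k >= 4\<close> enters twice: it keeps the middle coefficient of \<open>Q\<close>
  above \<open>-2 |a|\<close>, and for \<open>k > 4\<close> it keeps the pole \<open>4 - k\<close>
  of the Moebius map outside the range of integration. The single value \<open>4\<close> is a null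
  set.\<close>

text \<open>A relation carries integrability along with the value; a bare \<open>LINT\<close> would
  return 0 for a non-integrable function.\<close>

definition has_circle_mean :: "(complex \<Rightarrow> real) \<Rightarrow> real \<Rightarrow> bool" where
  "has_circle_mean f m \<longleftrightarrow>
     has_bochner_integral lborel (\<lambda>t. indicator {0..2*pi} t * f (cis t)) (2 * pi * m)"

lemma has_circle_mean_unique: "has_circle_mean f m \<Longrightarrow> has_circle_mean f n \<Longrightarrow> m = n"
  unfolding has_circle_mean_def using has_bochner_integral_eq by fastforce

lemma has_circle_mean_add:
  "has_circle_mean f m \<Longrightarrow> has_circle_mean g n \<Longrightarrow> has_circle_mean (\<lambda>z. f z + g z) (m + n)"
  unfolding has_circle_mean_def
  by (drule (1) has_bochner_integral_add) (simp add: algebra_simps)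

lemma has_circle_mean_const: "has_circle_mean (\<lambda>_. c) c"
  unfolding has_circle_mean_def has_bochner_integral_iff by simp

lemma countable_cis_eq: "countable {t. cis t = x}"
proof (cases "\<exists>t0. cis t0 = x")
  case True
  then obtain t0 where t0: "cis t0 = x" by blast
  have "{t. cis t = x} \<subseteq> range (\<lambda>n::int. t0 + 2 * pi * of_int n)"
  proof
    fix t assume "t \<in> {t. cis t = x}"
    then have "sin t = sin t0 \<and> cos t = cos t0"
      using t0 by (auto simp: complex_eq_iff)
    then obtain n :: int where "t = t0 + 2 * pi * n"
      using sin_cos_eq_iff by metis
    then show "t \<in> range (\<lambda>n::int. t0 + 2 * pi * of_int n)" by blast
  qed
  then show ?thesis by (rule countable_subset) simp
next
  case False
  then have "{t. cis t = x} = {}" by blast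
  then show ?thesis by (metis countable_empty)
qed

text \<open>Since \<open>ln 0 = 0\<close>, the law \<open>ln (x * y) = ln x + ln y\<close> fails
  where a factor vanishes. The finite set \<open>X\<close> absorbs these zeros.\<close>

lemma has_circle_mean_cong:
  assumes "finite X" and "\<And>z. cmod z = 1 \<Longrightarrow> z \<notin> X \<Longrightarrow> f z = g z" and "has_circle_mean f m"
  shows "has_circle_mean g m"
proof -
  have c: "countable (\<Union>x\<in>X. {t. cis t = x})"
    using assms(1) by (intro countable_UN countable_cis_eq countable_finite)
  show ?thesis
    using assms(3) unfolding has_circle_mean_def
    by (rule has_bochner_integral_discrete_difference[OF c, THEN iffD1, rotated 3])
       (use assms(2) in auto)
qed

text \<open>With \<open>w = cis s\<close> the interval is cut at \<open>s\<close>. Translation moves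
  \<open>{s..2*pi}\<close> to the front and \<open>{0..s}\<close> to the back; the shared endpoint
  is a null set.\<close>

lemma has_circle_mean_rotate:
  assumes "has_circle_mean f m" and "cmod w = 1"
  shows "has_circle_mean (\<lambda>z. f (w * z)) m"
proof -
  obtain s where s: "0 \<le> s" "s < 2 * pi" "w = cis s"
  proof
    show "0 \<le> Arg2pi w" "Arg2pi w < 2 * pi" by (rule Arg2pi_ge_0, rule Arg2pi_lt_2pi)
    show "w = cis (Arg2pi w)"
      using Arg2pi_eq[of w] assms(2) by (simp add: cis_conv_exp)
  qed
  let ?I = "2 * pi * m"
  let ?g = "\<lambda>t. f (cis t)"
  have I: "has_bochner_integral lborel (\<lambda>t. indicator {0..2*pi} t * ?g t) ?I"
    using assms(1) by (simp add: has_circle_mean_def)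
  have int: "integrable lborel (\<lambda>t. indicator {a..b} t * ?g t)" if "0 \<le> a" "b \<le> 2 * pi" for a b
  proof -
    have "integrable lborel (\<lambda>t. indicator {a..b} t *\<^sub>R (indicator {0..2*pi} t * ?g t))"
      using I by (intro integrable_mult_indicator) (auto simp: has_bochner_integral_iff)
    moreover have "(\<lambda>t. indicator {a..b} t *\<^sub>R (indicator {0..2*pi} t * ?g t))
        = (\<lambda>t. indicator {a..b} t * ?g t)"
      using that by (auto simp: fun_eq_iff indicator_def)
    ultimately show ?thesis by simp
  qed
  define A where "A = (LINT t|lborel. indicator {s..2*pi} t * ?g t)"
  define B where "B = (LINT t|lborel. indicator {0..s} t * ?g t)"
  have A: "has_bochner_integral lborel (\<lambda>t. indicator {s..2*pi} t * ?g t) A"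
    using int[of s "2*pi"] s by (simp add: A_def has_bochner_integral_iff)
  have B: "has_bochner_integral lborel (\<lambda>t. indicator {0..s} t * ?g t) B"
    using int[of 0 s] s by (simp add: B_def has_bochner_integral_iff)
  have "has_bochner_integral lborel (\<lambda>t. indicator {0..2*pi} t * ?g t) (A + B)"
    using has_bochner_integral_add[OF A B]
    by (rule has_bochner_integral_discrete_difference[where X="{s}", THEN iffD1, rotated 4])
       (use s in \<open>auto simp: indicator_def\<close>)
  then have AB: "A + B = ?I" using I has_bochner_integral_eq by blast
  have A': "has_bochner_integral lborel (\<lambda>t. indicator {0..2*pi-s} t * ?g (s + t)) A"
  proof -
    have "has_bochner_integral lborel (\<lambda>t. indicator {s..2*pi} (s + 1 * t) * ?g (s + 1 * t)) (A /\<^sub>R \<bar>1\<bar>)"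
      using lborel_has_bochner_integral_real_affine_iff[of 1, THEN iffD1, OF _ A] by simp
    moreover have "(\<lambda>t. indicator {s..2*pi} (s + 1 * t) * ?g (s + 1 * t)) =
        (\<lambda>t. indicator {0..2*pi-s} t * ?g (s + t))"
      by (auto simp: fun_eq_iff indicator_def)
    ultimately show ?thesis by simp
  qed
  have B': "has_bochner_integral lborel (\<lambda>t. indicator {2*pi-s..2*pi} t * ?g (s + t)) B"
  proof -
    have "has_bochner_integral lborel (\<lambda>t. indicator {0..s} ((s-2*pi) + 1 * t) * ?g ((s-2*pi) + 1 * t)) (B /\<^sub>R \<bar>1\<bar>)"
      using lborel_has_bochner_integral_real_affine_iff[of 1, THEN iffD1, OF _ B] by simp
    moreover have "cis (s - 2*pi + t) = cis (s + t)" for t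
      by (auto simp: complex_eq_iff cos_diff sin_diff algebra_simps cos_add sin_add)
    then have "(\<lambda>t. indicator {0..s} ((s-2*pi) + 1 * t) * ?g ((s-2*pi) + 1 * t)) =
        (\<lambda>t. indicator {2*pi-s..2*pi} t * ?g (s + t))"
      by (auto simp: fun_eq_iff indicator_def)
    ultimately show ?thesis by simp
  qed
  have "has_bochner_integral lborel (\<lambda>t. indicator {0..2*pi} t * ?g (s + t)) (A + B)"
    using has_bochner_integral_add[OF A' B']
    by (rule has_bochner_integral_discrete_difference[where X="{2*pi-s}", THEN iffD1, rotated 4])
       (use s in \<open>auto simp: indicator_def\<close>)
  then show ?thesis unfolding has_circle_mean_def AB s by (simp add: cis_mult)
qed

text \<open>Squaring winds twice around the circle, so each half circle contributes half of the
  integral.\<close>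

lemma has_circle_mean_square:
  assumes "has_circle_mean f m"
  shows "has_circle_mean (\<lambda>z. f (z^2)) m"
proof -
  let ?I = "2 * pi * m"
  let ?g = "\<lambda>t. f (cis t)"
  have I: "has_bochner_integral lborel (\<lambda>t. indicator {0..2*pi} t * ?g t) ?I"
    using assms(1) by (simp add: has_circle_mean_def)
  have A: "has_bochner_integral lborel (\<lambda>t. indicator {0..pi} t * ?g (2 * t)) (?I / 2)"
  proof -
    have "has_bochner_integral lborel (\<lambda>t. indicator {0..2*pi} (0 + 2 * t) * ?g (0 + 2 * t)) (?I /\<^sub>R \<bar>2\<bar>)"
      by (rule lborel_has_bochner_integral_real_affine_iff[of 2, THEN iffD1, OF _ I]) simp
    moreover have "(\<lambda>t. indicator {0..2*pi} (0 + 2 * t) * ?g (0 + 2 * t)) =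
        (\<lambda>t. indicator {0..pi} t * ?g (2 * t))"
      by (auto simp: fun_eq_iff indicator_def)
    moreover have "?I /\<^sub>R \<bar>2\<bar> = ?I / 2" by simp
    ultimately show ?thesis by (simp only:)
  qed
  have B: "has_bochner_integral lborel (\<lambda>t. indicator {pi..2*pi} t * ?g (2 * t)) (?I / 2)"
  proof -
    have "has_bochner_integral lborel (\<lambda>t. indicator {0..2*pi} (-2*pi + 2 * t) * ?g (-2*pi + 2 * t)) (?I /\<^sub>R \<bar>2\<bar>)"
      by (rule lborel_has_bochner_integral_real_affine_iff[of 2, THEN iffD1, OF _ I]) simp
    moreover have "cis (- 2*pi + t) = cis t" for t
      by (simp add: complex_eq_iff cos_add sin_add cos_diff sin_diff)
    then have "(\<lambda>t. indicator {0..2*pi} (-2*pi + 2 * t) * ?g (-2*pi + 2 * t)) =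
        (\<lambda>t. indicator {pi..2*pi} t * ?g (2 * t))"
      by (auto simp: fun_eq_iff indicator_def)
    moreover have "?I /\<^sub>R \<bar>2\<bar> = ?I / 2" by simp
    ultimately show ?thesis by (simp only:)
  qed
  have "has_bochner_integral lborel (\<lambda>t. indicator {0..2*pi} t * ?g (2 * t)) (?I/2 + ?I/2)"
    using has_bochner_integral_add[OF A B]
    by (rule has_bochner_integral_discrete_difference[where X="{pi}", THEN iffD1, rotated 4])
       (auto simp: indicator_def)
  moreover have "?I/2 + ?I/2 = ?I" by simp
  ultimately show ?thesis unfolding has_circle_mean_def by (simp add: Complex.DeMoivre mult.assoc)
qed

lemma has_circle_mean_bounded:
  assumes "f \<in> borel_measurable borel" and "\<And>z. cmod z = 1 \<Longrightarrow> \<bar>f z\<bar> \<le> C"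
  obtains m where "has_circle_mean f m" "\<bar>m\<bar> \<le> C"
proof -
  note [measurable] = assms(1)
  have [measurable]: "cis \<in> borel_measurable borel"
    by (intro borel_measurable_continuous_onI continuous_intros)
  have int: "integrable lborel (\<lambda>t. indicator {0..2*pi} t * f (cis t))"
  proof (rule Bochner_Integration.integrable_bound)
    show "integrable lborel (\<lambda>t. indicator {0..2*pi} t * C)" by simp
    show "AE t in lborel. norm (indicator {0..2*pi} t * f (cis t)) \<le> norm (indicator {0..2*pi} t * C)"
      using assms(2) by (auto simp: indicator_def intro!: AE_I2 order_trans[OF _ abs_ge_self])
  qed simp
  define I where "I = (LINT t|lborel. indicator {0..2*pi} t * f (cis t))"
  have "\<bar>I\<bar> \<le> (LINT t|lborel. \<bar>indicator {0..2*pi} t * f (cis t)\<bar>)"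
    unfolding I_def by (rule integral_abs_bound)
  also have "\<dots> \<le> (LINT t|lborel. indicator {0..2*pi} t * C)"
  proof (rule integral_mono)
    show "integrable lborel (\<lambda>t. indicator {0..2*pi} t * C)" by simp
    show "integrable lborel (\<lambda>t. \<bar>indicator {0..2*pi} t * f (cis t)\<bar>)"
      using int by (rule integrable_abs)
    show "\<bar>indicator {0..2*pi} t * f (cis t)\<bar> \<le> indicator {0..2*pi} t * C" for t
      using assms(2) by (auto simp: indicator_def)
  qed
  also have "\<dots> = 2 * pi * C" by simp
  finally have "\<bar>I / (2*pi)\<bar> \<le> C" by (simp add: field_simps abs_divide)
  moreover have "has_circle_mean f (I / (2*pi))"
    unfolding has_circle_mean_def has_bochner_integral_iff using int by (simp add: I_def)
  ultimately show ?thesis using that by blast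
qed

section \<open>Logarithmic means of linear factors\<close>

lemma abs_ln_cmod_1_minus_le:
  assumes "cmod z \<le> r" "r < 1"
  shows "\<bar>ln (cmod (1 - z))\<bar> \<le> - ln (1 - r)"
proof -
  have r: "0 \<le> r" using assms norm_ge_zero order_trans by blast
  have 1: "1 - r \<le> cmod (1 - z)" using norm_triangle_ineq2[of 1 z] assms by simp
  have "cmod (1 - z) \<le> 1 + r" using norm_triangle_ineq4[of 1 z] assms by simp
  also have "\<dots> \<le> 1 / (1 - r)" using assms(2) by (simp add: field_simps)
  finally have "ln (cmod (1 - z)) \<le> ln (1 / (1 - r))" using 1 assms by (intro ln_mono) auto
  moreover have "ln (1 - r) \<le> ln (cmod (1 - z))" using 1 assms by (intro ln_mono) auto
  ultimately show ?thesis using assms by (simp add: ln_div)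
qed

text \<open>The mean \<open>m r\<close> for radius \<open>r\<close> satisfies \<open>2 * m r = m (r\<^sup>2)\<close>, because
  \<open>(1 - r z) (1 + r z) = 1 - r\<^sup>2 z\<^sup>2\<close>. Being bounded near \<open>0\<close>, it vanishes for \<open>r < 1\<close>;
  for \<open>r = 1\<close> the equation reads \<open>2 * m 1 = m 1\<close>.\<close>

lemma circle_mean_ln_functional_equation:
  assumes m: "has_circle_mean (\<lambda>z. ln (cmod (1 - of_real r * z))) m"
    and n: "has_circle_mean (\<lambda>z. ln (cmod (1 - of_real (r^2) * z))) n"
  shows "n = 2 * m"
proof -
  have "has_circle_mean (\<lambda>z. ln (cmod (1 - of_real r * (-1 * z)))) m"
    using has_circle_mean_rotate[OF m, of "-1"] by simp
  from has_circle_mean_add[OF m this]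
  have "has_circle_mean (\<lambda>z. ln (cmod (1 - of_real r * z)) + ln (cmod (1 - of_real r * (-1 * z)))) (m + m)" .
  then have "has_circle_mean (\<lambda>z. ln (cmod (1 - of_real (r^2) * z^2))) (m + m)"
  proof (rule has_circle_mean_cong[where X="{1 / of_real r, - 1 / of_real r}", rotated 2])
    fix z :: complex
    assume z: "z \<notin> {1 / of_real r, - 1 / of_real r}"
    have "1 - of_real r * z \<noteq> 0"
      using z by (cases "r = 0") (auto simp: field_simps)
    moreover have "1 - of_real r * (-1 * z) \<noteq> 0"
    proof
      assume "1 - of_real r * (-1 * z) = 0"
      then have "r \<noteq> 0" "of_real r * z = - 1" by (auto simp: eq_neg_iff_add_eq_0 add.commute)
      then have "z = -1 / of_real r" by (simp add: field_simps)
      then show False using z by blast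
    qed
    ultimately have "ln (cmod (1 - of_real r * z)) + ln (cmod (1 - of_real r * (-1 * z)))
        = ln (cmod ((1 - of_real r * z) * (1 - of_real r * (-1 * z))))"
      by (simp add: norm_mult ln_mult)
    also have "(1 - of_real r * z) * (1 - of_real r * (-1 * z)) = 1 - of_real (r^2) * z^2"
      by (simp add: algebra_simps power2_eq_square)
    finally show "ln (cmod (1 - of_real r * z)) + ln (cmod (1 - of_real r * (-1 * z)))
        = ln (cmod (1 - of_real (r^2) * z^2))" .
  qed simp
  moreover have "has_circle_mean (\<lambda>z. ln (cmod (1 - of_real (r^2) * z^2))) n"
    using has_circle_mean_square[OF n] by simp
  ultimately show ?thesis using has_circle_mean_unique by fastforce
qed

lemma circle_mean_ln_radius_less_1:
  assumes "0 \<le> r" "r < 1"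
  shows "has_circle_mean (\<lambda>z. ln (cmod (1 - of_real r * z))) 0"
proof -
  define C where "C = - ln (1 - r)"
  define m where "m s = (SOME m. has_circle_mean (\<lambda>z. ln (cmod (1 - of_real s * z))) m)" for s :: real
  have ex: "\<exists>m. has_circle_mean (\<lambda>z. ln (cmod (1 - of_real s * z))) m \<and> \<bar>m\<bar> \<le> C"
    if "0 \<le> s" "s \<le> r" for s
    by (rule has_circle_mean_bounded[of "\<lambda>z. ln (cmod (1 - of_real s * z))" C])
       (use that assms in \<open>auto simp: C_def norm_mult intro!: abs_ln_cmod_1_minus_le\<close>)
  have m: "has_circle_mean (\<lambda>z. ln (cmod (1 - of_real s * z))) (m s)" "\<bar>m s\<bar> \<le> C"
    if s: "0 \<le> s" "s \<le> r" for s
  proof -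
    obtain m' where m': "has_circle_mean (\<lambda>z. ln (cmod (1 - of_real s * z))) m'" "\<bar>m'\<bar> \<le> C"
      using ex[OF s] by blast
    show 1: "has_circle_mean (\<lambda>z. ln (cmod (1 - of_real s * z))) (m s)"
      unfolding m_def by (rule someI, rule m'(1))
    show "\<bar>m s\<bar> \<le> C" using has_circle_mean_unique[OF 1 m'(1)] m'(2) by simp
  qed
  \<comment> \<open>Replacing \<open>s\<close> by \<open>s^2\<close> doubles the mean and keeps the
    radius below \<open>r\<close>, where the same constant \<open>C\<close> applies.\<close>
  have bd: "2 ^ n * \<bar>m s\<bar> \<le> C" if "0 \<le> s" "s \<le> r" for n s
    using that
  proof (induction n arbitrary: s)
    case 0
    then show ?case using m(2) by simp
  next
    case (Suc n)
    have "s * s \<le> 1 * s" using Suc.prems assms by (intro mult_right_mono) auto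
    then have s2: "0 \<le> s^2" "s^2 \<le> r" using Suc.prems by (auto simp: power2_eq_square)
    have "m (s^2) = 2 * m s"
      by (rule circle_mean_ln_functional_equation[OF m(1) m(1)]) (use s2 Suc.prems in auto)
    then show ?case using Suc.IH[OF s2] by (simp add: abs_mult)
  qed
  have "m r = 0"
  proof (rule ccontr)
    assume "m r \<noteq> 0"
    then obtain n where "C / \<bar>m r\<bar> < 2 ^ n"
      using real_arch_pow[of 2 "C / \<bar>m r\<bar>"] by auto
    then show False using bd[of r n] assms \<open>m r \<noteq> 0\<close> by (simp add: field_simps)
  qed
  then show ?thesis using m(1)[of r] assms by simp
qed

text \<open>The functional equation forces the value 0 as soon as the singularity at
  \<open>z = 1\<close> is known to be integrable. Fatou's lemma shows this: the functions
  \<open>ln 2 - ln (cmod (1 - r n * z))\<close> are nonnegative and all have integral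
  \<open>2 * pi * ln 2\<close>. Convergence of the integrals is never asked for.\<close>

lemma circle_mean_ln_radius_1: "has_circle_mean (\<lambda>z. ln (cmod (1 - z))) 0"
proof -
  have [measurable]: "cis \<in> borel_measurable borel"
    by (intro borel_measurable_continuous_onI continuous_intros)
  define r where "r n = 1 - 1 / real (Suc n)" for n
  have r: "0 \<le> r n" "r n < 1" for n by (auto simp: r_def)
  have rlim: "r \<longlonglongrightarrow> 1"
    unfolding r_def
    using tendsto_diff[OF tendsto_const[of 1] LIMSEQ_inverse_real_of_nat] by (simp add: inverse_eq_divide)
  define g where "g n t = ennreal (indicator {0..2*pi} t * (ln 2 - ln (cmod (1 - of_real (r n) * cis t))))" for n t
  have le2: "ln (cmod (1 - of_real s * cis t)) \<le> ln 2" if "0 \<le> s" "s \<le> 1" for s t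
  proof (cases "1 - of_real s * cis t = 0")
    case False
    have "cmod (1 - of_real s * cis t) \<le> 2"
      using norm_triangle_ineq4[of 1 "of_real s * cis t"] that by (simp add: norm_mult)
    then show ?thesis using False by (intro ln_mono) auto
  qed simp
  have g_int: "(\<integral>\<^sup>+t. g n t \<partial>lborel) = ennreal (2 * pi * ln 2)" for n
  proof -
    have "has_circle_mean (\<lambda>z. ln 2 - ln (cmod (1 - of_real (r n) * z))) (ln 2 - 0)"
      unfolding has_circle_mean_def
      using has_bochner_integral_diff[OF has_circle_mean_const[of "ln 2", unfolded has_circle_mean_def]
        circle_mean_ln_radius_less_1[OF r[of n], unfolded has_circle_mean_def]]
      by (simp add: algebra_simps)
    then have "has_bochner_integral lborel (\<lambda>t. indicator {0..2*pi} t * (ln 2 - ln (cmod (1 - of_real (r n) * cis t)))) (2 * pi * ln 2)"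
      by (simp add: has_circle_mean_def)
    then show ?thesis unfolding g_def
      by (subst nn_integral_eq_integral)
         (use le2[of "r n"] r[of n] in \<open>auto simp: has_bochner_integral_iff intro!: AE_I2\<close>)
  qed
  define G where "G t = indicator {0..2*pi} t * (ln 2 - ln (cmod (1 - cis t)))" for t
  have "AE t in lborel. t \<notin> {0, 2*pi}"
    by (intro AE_not_in finite_imp_null_set_lborel) simp
  then have lim: "AE t in lborel. ennreal (G t) = liminf (\<lambda>n. g n t)"
  proof eventually_elim
    case (elim t)
    show ?case
    proof (cases "t \<in> {0..2*pi}")
      case True
      have "cis t \<noteq> 1"
      proof
        assume "cis t = 1"
        then have "cos t = 1" by (simp add: complex_eq_iff)
        then obtain n :: int where "t = of_int n * 2 * pi"
          using cos_one_2pi_int by blast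
        moreover have "0 < t" "t < 2 * pi" using True elim by auto
        ultimately have "0 < (2 * pi) * of_int n" "(2 * pi) * of_int n < (2 * pi) * 1"
          by (simp_all add: mult.commute mult.left_commute)
        then have "0 < (of_int n :: real)" "(of_int n :: real) < 1"
          by (simp_all only: zero_less_mult_iff mult_less_cancel_left_pos) auto
        then have "0 < n" "n < 1" by simp_all
        then show False by linarith
      qed
      then have "(\<lambda>n. ln 2 - ln (cmod (1 - of_real (r n) * cis t))) \<longlonglongrightarrow> ln 2 - ln (cmod (1 - of_real 1 * cis t))"
        by (intro tendsto_intros rlim) auto
      then have "(\<lambda>n. g n t) \<longlonglongrightarrow> ennreal (G t)"
        unfolding g_def G_def using True by (intro tendsto_ennrealI) auto
      then show ?thesis using lim_imp_Liminf[of sequentially] by fastforce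
    next
      case False
      then show ?thesis by (simp add: g_def G_def Liminf_const)
    qed
  qed
  have "(\<integral>\<^sup>+t. ennreal (G t) \<partial>lborel) = (\<integral>\<^sup>+t. liminf (\<lambda>n. g n t) \<partial>lborel)"
    by (intro nn_integral_cong_AE lim)
  also have "\<dots> \<le> liminf (\<lambda>n. \<integral>\<^sup>+t. g n t \<partial>lborel)"
    by (intro nn_integral_liminf) (simp add: g_def)
  also have "\<dots> < \<infinity>" by (simp add: g_int Liminf_const)
  finally have "integrable lborel G"
    by (intro integrableI_nonneg) (use le2[of 1] in \<open>auto simp: G_def[abs_def] intro!: AE_I2\<close>)
  then have "integrable lborel (\<lambda>t. indicator {0..2*pi} t * ln 2 - G t)" by simp
  moreover have "(\<lambda>t. indicator {0..2*pi} t * ln 2 - G t) = (\<lambda>t. indicator {0..2*pi} t * ln (cmod (1 - cis t)))"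
    by (auto simp: G_def indicator_def fun_eq_iff)
  ultimately have "integrable lborel (\<lambda>t. indicator {0..2*pi} t * ln (cmod (1 - cis t)))" by simp
  then have "has_circle_mean (\<lambda>z. ln (cmod (1 - of_real 1 * z)))
      ((LINT t|lborel. indicator {0..2*pi} t * ln (cmod (1 - cis t))) / (2 * pi))" (is "has_circle_mean _ ?m")
    unfolding has_circle_mean_def has_bochner_integral_iff by simp
  then obtain m where m: "has_circle_mean (\<lambda>z. ln (cmod (1 - of_real 1 * z))) m" by blast
  then have "m = 2 * m" using circle_mean_ln_functional_equation[of 1 m m] by simp
  then show ?thesis using m by simp
qed

lemma circle_mean_ln_cmod_1_minus:
  assumes "cmod a \<le> 1"
  shows "has_circle_mean (\<lambda>z. ln (cmod (1 - a * z))) 0"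
proof -
  have 1: "has_circle_mean (\<lambda>z. ln (cmod (1 - of_real (cmod a) * z))) 0"
    using assms circle_mean_ln_radius_less_1[of "cmod a"] circle_mean_ln_radius_1
    by (cases "cmod a = 1") auto
  define w where "w = cis (Arg a)"
  have w: "cmod w = 1" "a = of_real (cmod a) * w"
    using rcis_cmod_Arg[of a] by (simp_all add: w_def rcis_def)
  show ?thesis using has_circle_mean_rotate[OF 1 w(1)] w(2) by (simp flip: mult.assoc)
qed

text \<open>Both cases reduce to \<open>1 - c * z\<close> with \<open>cmod c \<le> 1\<close>, whose
  mean is 0: for \<open>a\<close> in the closed disc by the reflection
  \<open>z - a = z * cnj (1 - cnj a * z)\<close> on the circle, otherwise by factoring out
  \<open>a\<close>.\<close>

lemma circle_mean_jensen:
  "has_circle_mean (\<lambda>z. ln (cmod (z - a))) (ln (max 1 (cmod a)))"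
proof (cases "cmod a \<le> 1")
  case True
  have eq: "cmod (1 - cnj a * z) = cmod (z - a)" if "cmod z = 1" for z
  proof -
    have "z - a = z * cnj (1 - cnj a * z)"
      using that by (simp add: algebra_simps complex_norm_square[symmetric])
    then show ?thesis using that by (metis complex_mod_cnj mult_1 norm_mult)
  qed
  have "has_circle_mean (\<lambda>z. ln (cmod (1 - cnj a * z))) 0"
    using True by (intro circle_mean_ln_cmod_1_minus) simp
  then have "has_circle_mean (\<lambda>z. ln (cmod (z - a))) 0"
    by (rule has_circle_mean_cong[where X="{}", rotated 2]) (simp_all add: eq)
  then show ?thesis using True by (simp add: max_def)
next
  case False
  have "has_circle_mean (\<lambda>z. ln (cmod a) + ln (cmod (1 - (1/a) * z))) (ln (cmod a) + 0)"
    using False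
    by (intro has_circle_mean_add has_circle_mean_const circle_mean_ln_cmod_1_minus)
       (auto simp: norm_divide divide_simps)
  then have "has_circle_mean (\<lambda>z. ln (cmod (z - a))) (ln (cmod a) + 0)"
  proof (rule has_circle_mean_cong[where X="{a}", rotated 2])
    fix z assume "z \<notin> {a}"
    then have "z - a \<noteq> 0" "a \<noteq> 0" using False by auto
    then have "ln (cmod a) + ln (cmod (1 - (1/a) * z)) = ln (cmod (a * (1 - (1/a) * z)))"
      unfolding norm_mult by (subst ln_mult) (auto simp: field_simps)
    also have "a * (1 - (1/a) * z) = - (z - a)" using \<open>a \<noteq> 0\<close> by (simp add: field_simps)
    finally show "ln (cmod a) + ln (cmod (1 - (1/a) * z)) = ln (cmod (z - a))"
      by (simp add: norm_minus_commute)
  qed simp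
  then show ?thesis using False by (simp add: max_def)
qed

section \<open>Circle means of self-reciprocal quadratics\<close>

text \<open>For \<open>0 < a\<close> and \<open>2 * a \<le> b\<close> this is \<open>ln\<close> of
  \<open>a\<close> times the larger root modulus of \<open>a (z^2 + 1) + b z\<close>. Truncation by
  \<open>max\<close> covers roots on the unit circle: the square root vanishes and
  \<open>ln a\<close> remains.\<close>

definition quadratic_mean :: "real \<Rightarrow> real \<Rightarrow> real" where
  "quadratic_mean a b = ln ((max b (2*a) + sqrt ((max b (2*a))^2 - 4 * a^2)) / 2)"

lemma circle_mean_factored:
  assumes "a \<noteq> 0"
  shows "has_circle_mean (\<lambda>z. ln (cmod (a * ((z - r) * (z - s)))))
    (ln (cmod a) + (ln (max 1 (cmod r)) + ln (max 1 (cmod s))))"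
proof -
  have "has_circle_mean (\<lambda>z. ln (cmod a) + (ln (cmod (z - r)) + ln (cmod (z - s))))
    (ln (cmod a) + (ln (max 1 (cmod r)) + ln (max 1 (cmod s))))"
    by (intro has_circle_mean_add has_circle_mean_const circle_mean_jensen)
  then show ?thesis
    by (rule has_circle_mean_cong[where X="{r, s}", rotated 2])
       (use assms in \<open>auto simp: norm_mult ln_mult\<close>)
qed

text \<open>If \<open>a\<close> is nonzero, the roots have product 1: either a conjugate pair on the
  circle or a real pair with one root outside it. Only an outside root contributes to Jensen's
  formula.\<close>

lemma circle_mean_quadratic:
  fixes a b :: real
  assumes "a \<noteq> 0 \<or> b \<noteq> 0"
  shows "has_circle_mean (\<lambda>z. ln (cmod (of_real a * (z^2 + 1) + of_real b * z)))
    (quadratic_mean \<bar>a\<bar> \<bar>b\<bar>)"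
proof (cases "a = 0")
  case True
  have "has_circle_mean (\<lambda>z. ln (cmod (of_real a * (z^2 + 1) + of_real b * z))) (ln \<bar>b\<bar>)"
    by (rule has_circle_mean_cong[where X="{}", OF _ _ has_circle_mean_const])
       (use True in \<open>auto simp: norm_mult\<close>)
  then show ?thesis using True by (simp add: quadratic_mean_def)
next
  case False
  have mean: ?thesis
    if sum: "r + s = - of_real b / of_real a" and prod: "r * s = 1"
      and val: "ln \<bar>a\<bar> + (ln (max 1 (cmod r)) + ln (max 1 (cmod s))) = quadratic_mean \<bar>a\<bar> \<bar>b\<bar>"
    for r s :: complex
  proof -
    have "of_real a * ((z - r) * (z - s)) = of_real a * (z^2 + 1) + of_real b * z" for z
    proof -
      have "of_real a * ((z - r) * (z - s)) = of_real a * (z^2 - (r + s) * z + r * s)"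
        by (simp add: algebra_simps power2_eq_square)
      also have "\<dots> = of_real a * (z^2 + 1) + of_real b * z"
        unfolding sum prod using False by (simp add: field_simps)
      finally show ?thesis .
    qed
    then show ?thesis
      using circle_mean_factored[of "of_real a" r s] False val by simp
  qed
  show ?thesis
  proof (cases "\<bar>b\<bar> \<le> 2 * \<bar>a\<bar>")
    case True
    define c where "c = b / (2 * a)"
    have "\<bar>c\<bar> \<le> 1" using True False by (simp add: c_def abs_divide abs_mult divide_simps)
    then have c: "c^2 \<le> 1" by (simp add: abs_square_le_1)
    define r where "r = Complex (- c) (sqrt (1 - c^2))"
    have "cmod r = 1" using c by (simp add: r_def cmod_def)
    show ?thesis
    proof (rule mean[of r "cnj r"])
      show "r + cnj r = - of_real b / of_real a"
        by (simp add: complex_add_cnj) (simp add: r_def c_def)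
      show "r * cnj r = 1" using \<open>cmod r = 1\<close> by (simp add: complex_norm_square[symmetric])
      show "ln \<bar>a\<bar> + (ln (max 1 (cmod r)) + ln (max 1 (cmod (cnj r)))) = quadratic_mean \<bar>a\<bar> \<bar>b\<bar>"
        using \<open>cmod r = 1\<close> True by (simp add: quadratic_mean_def max_def power_mult_distrib)
    qed
  next
    case big: False
    define d where "d = sqrt (b^2 - 4 * a^2)"
    have "(2 * \<bar>a\<bar>)^2 < \<bar>b\<bar>^2" using big by (intro power_strict_mono) auto
    then have dd: "0 < d" "d * d = b^2 - 4 * a^2"
      by (simp_all add: d_def power_mult_distrib)
    \<comment> \<open>The sign makes \<open>b\<close> and \<open>e * d\<close> add up without
      cancellation, so \<open>r\<close> is always the root outside the circle.\<close>
    define e where "e = sgn b"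
    have e: "e * e = 1" "e * b = \<bar>b\<bar>" "e = 1 \<or> e = -1" using big by (auto simp: e_def sgn_if)
    define r where "r = - (b + e * d) / (2 * a)"
    define s where "s = - (b - e * d) / (2 * a)"
    have "r * s = (b^2 - (e * e) * (d * d)) / (4 * a^2)"
      by (simp add: r_def s_def field_simps power2_eq_square)
    then have rs: "r * s = 1" using False e dd by simp
    have "\<bar>b + e * d\<bar> = \<bar>b\<bar> + d" using dd(1) big by (auto simp: e_def sgn_if abs_if)
    then have r: "\<bar>r\<bar> = (\<bar>b\<bar> + d) / (2 * \<bar>a\<bar>)" by (simp only: r_def abs_divide abs_minus_cancel abs_mult abs_numeral)
    then have r1: "1 < \<bar>r\<bar>" unfolding r using big dd(1) False by (simp add: less_divide_eq)
    have "\<bar>r\<bar> * \<bar>s\<bar> = 1" using rs by (simp flip: abs_mult)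
    then have s1: "\<bar>s\<bar> \<le> 1" using mult_right_mono[of 1 "\<bar>r\<bar>" "\<bar>s\<bar>"] r1 by simp
    show ?thesis
    proof (rule mean[of "of_real r" "of_real s"])
      show "of_real r + of_real s = - complex_of_real b / of_real a"
      proof -
        have "r + s = - b / a" using False by (simp add: r_def s_def field_simps)
        then have "complex_of_real (r + s) = of_real (- b / a)" by (simp only:)
        then show ?thesis by simp
      qed
      show "complex_of_real r * of_real s = 1" using rs by (simp flip: of_real_mult)
      have "ln \<bar>a\<bar> + ln \<bar>r\<bar> = ln (\<bar>a\<bar> * \<bar>r\<bar>)" using False r1 by (subst ln_mult) auto
      also have "\<bar>a\<bar> * \<bar>r\<bar> = (\<bar>b\<bar> + d) / 2" using False by (simp add: r)
      finally show "ln \<bar>a\<bar> + (ln (max 1 (cmod (of_real r))) + ln (max 1 (cmod (of_real s))))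
          = quadratic_mean \<bar>a\<bar> \<bar>b\<bar>"
        using r1 s1 big by (simp add: quadratic_mean_def d_def max_def)
    qed
  qed
qed

section \<open>Fubini on the torus\<close>

text \<open>\<open>ln (cmod F)\<close> is unbounded below near zeros of \<open>F\<close>, so
  absolute integrability has to be earned. From an upper bound \<open>f \<le> C'\<close> follows
  \<open>\<bar>f\<bar> \<le> 2 * C' - f\<close>; the inner integral of \<open>\<bar>f\<bar>\<close>
  is then controlled by the inner mean, which \<open>B\<close> bounds.\<close>

lemma mahler2_eq_integral_circle_mean:
  assumes cont: "continuous_on UNIV (\<lambda>p. F (fst p) (snd p))"
    and G: "\<And>x. cmod x = 1 \<Longrightarrow> has_circle_mean (\<lambda>y. ln (cmod (F x y))) (G x)"
    and B: "\<And>x. cmod x = 1 \<Longrightarrow> \<bar>G x\<bar> \<le> B"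
  shows "mahler2 F = (LINT t|lborel. indicator {0..2*pi} t * G (cis t)) / (2 * pi)"
    and "integrable lborel (\<lambda>t. indicator {0..2*pi} t * G (cis t))"
proof -
  have "continuous_on UNIV (\<lambda>p. (cis (fst p), cis (snd p)))" by (intro continuous_intros)
  from continuous_on_compose2[OF cont this]
  have "continuous_on UNIV (\<lambda>p. F (cis (fst p)) (cis (snd p)))" by simp
  then have [measurable]: "(\<lambda>p. F (cis (fst p)) (cis (snd p))) \<in> borel_measurable borel"
    by (rule borel_measurable_continuous_onI)
  have meas: "(\<lambda>p. ln (cmod (F (cis (fst p)) (cis (snd p))))) \<in> borel_measurable borel"
    by measurable
  have "bounded ((\<lambda>p. F (fst p) (snd p)) ` (sphere 0 1 \<times> sphere 0 1))"
    by (intro compact_imp_bounded compact_continuous_image continuous_on_subset[OF cont]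
        compact_Times compact_sphere subset_UNIV)
  then obtain C where "\<forall>p\<in>sphere 0 1 \<times> sphere 0 1. cmod (F (fst p) (snd p)) \<le> C"
    unfolding bounded_iff by auto
  then have C: "cmod (F x y) \<le> C" if "cmod x = 1" "cmod y = 1" for x y
    using that by force
  let ?f = "\<lambda>s t. ln (cmod (F (cis s) (cis t)))"
  let ?g = "\<lambda>p. indicator {0..2*pi} (fst p) * (indicator {0..2*pi} (snd p) * ?f (fst p) (snd p)) :: real"
  have sets: "sets (lborel \<Otimes>\<^sub>M lborel) = sets (borel :: (real \<times> real) measure)"
    by (metis lborel_prod sets_lborel)
  have "fst \<in> borel_measurable (borel :: (real \<times> real) measure)"
    "snd \<in> borel_measurable (borel :: (real \<times> real) measure)"
    by (auto intro!: borel_measurable_continuous_onI continuous_intros)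
  note [measurable] = meas this
  have "?g \<in> borel_measurable borel" by measurable
  then have g_meas: "?g \<in> borel_measurable (lborel \<Otimes>\<^sub>M lborel)"
    using measurable_cong_sets[OF sets refl] by blast
  \<comment> \<open>At zeros of \<open>F\<close> the integrand is \<open>ln 0 = 0\<close>, which
    \<open>ln C\<close> need not dominate.\<close>
  define C' where "C' = max 0 (ln C)"
  have f_le: "?f s t \<le> C'" for s t
  proof (cases "F (cis s) (cis t) = 0")
    case False
    then have "?f s t \<le> ln C" using C[of "cis s" "cis t"] by (intro ln_mono) auto
    then show ?thesis by (simp add: C'_def)
  qed (simp add: C'_def)
  have C'0: "0 \<le> C'" by (simp add: C'_def)
  have inner: "has_bochner_integral lborel (\<lambda>t. ?g (s, t)) (indicator {0..2*pi} s * (2 * pi * G (cis s)))" for s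
    using G[of "cis s"] unfolding has_circle_mean_def
    by (auto intro: has_bochner_integral_mult_right)
  have norm_inner: "(LINT t|lborel. norm (?g (s, t))) \<le> indicator {0..2*pi} s * (4 * pi * C' + 2 * pi * B)" for s
  proof (cases "s \<in> {0..2*pi}")
    case True
    have h: "has_bochner_integral lborel (\<lambda>t. indicator {0..2*pi} t * (2 * C') - ?g (s, t))
        (2 * pi * (2 * C') - indicator {0..2*pi} s * (2 * pi * G (cis s)))"
      by (intro has_bochner_integral_diff inner
           has_circle_mean_const[of "2 * C'", unfolded has_circle_mean_def])
    have "(LINT t|lborel. norm (?g (s, t))) \<le> (LINT t|lborel. indicator {0..2*pi} t * (2 * C') - ?g (s, t))"
    proof (rule integral_mono)
      show "integrable lborel (\<lambda>t. norm (?g (s, t)))"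
        using inner[of s] by (intro integrable_norm) (simp add: has_bochner_integral_iff)
      show "integrable lborel (\<lambda>t. indicator {0..2*pi} t * (2 * C') - ?g (s, t))"
        using h by (simp add: has_bochner_integral_iff)
      show "norm (?g (s, t)) \<le> indicator {0..2*pi} t * (2 * C') - ?g (s, t)" for t
        using f_le[of s t] C'0 by (auto simp: indicator_def)
    qed
    also have "\<dots> = 4 * pi * C' - 2 * pi * G (cis s)"
      using h True unfolding has_bochner_integral_iff by simp
    also have "\<dots> \<le> 4 * pi * C' + 2 * pi * B"
    proof -
      have "2 * pi * (- G (cis s)) \<le> 2 * pi * B"
        using B[of "cis s"] by (intro mult_left_mono) auto
      then show ?thesis by simp
    qed
    finally show ?thesis using True by simp
  qed simp
  have "integrable lborel (\<lambda>s. LINT t|lborel. norm (?g (s, t)))"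
  proof (rule Bochner_Integration.integrable_bound)
    show "integrable lborel (\<lambda>s. indicator {0..2*pi} s * (4 * pi * C' + 2 * pi * B))" by simp
    show "(\<lambda>s. LINT t|lborel. norm (?g (s, t))) \<in> borel_measurable lborel"
      using g_meas by (intro lborel.borel_measurable_lebesgue_integral) (simp add: case_prod_unfold)
    show "AE s in lborel. norm (LINT t|lborel. norm (?g (s, t))) \<le> norm (indicator {0..2*pi} s * (4 * pi * C' + 2 * pi * B))"
    proof (rule AE_I2)
      fix s
      have mono: "norm x \<le> norm y" if "0 \<le> x" "x \<le> y" for x y :: real using that by simp
      show "norm (LINT t|lborel. norm (?g (s, t))) \<le> norm (indicator {0..2*pi} s * (4 * pi * C' + 2 * pi * B))"
        by (rule mono[OF _ norm_inner]) (rule integral_nonneg_AE, simp)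
    qed
  qed
  then have g_int: "integrable (lborel \<Otimes>\<^sub>M lborel) ?g"
    by (rule lborel_pair.Fubini_integrable[OF g_meas])
       (use inner in \<open>auto simp: has_bochner_integral_iff\<close>)
  have inner_eq: "(LINT t|lborel. ?g (s, t)) = 2 * pi * (indicator {0..2*pi} s * G (cis s))" for s
    using has_bochner_integral_integral_eq[OF inner[of s]] by (simp only: mult.left_commute)
  have "(LINT p|lborel. ?g p) = (LINT p|(lborel \<Otimes>\<^sub>M lborel). ?g p)" by (simp add: lborel_prod)
  also have "\<dots> = (LINT s|lborel. LINT t|lborel. ?g (s, t))"
    using lborel_pair.integral_fst'[OF g_int] by simp
  also have "\<dots> = (LINT s|lborel. 2 * pi * (indicator {0..2*pi} s * G (cis s)))"
    unfolding inner_eq ..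
  also have "\<dots> = 2 * pi * (LINT s|lborel. indicator {0..2*pi} s * G (cis s))" by simp
  finally have "(LINT p|lborel. ?g p) = 2 * pi * (LINT s|lborel. indicator {0..2*pi} s * G (cis s))" .
  moreover have "(\<lambda>p. indicator ({0..2*pi} \<times> {0..2*pi}) p * ?f (fst p) (snd p)) = ?g"
    by (auto simp: fun_eq_iff indicator_def)
  ultimately show "mahler2 F = (LINT t|lborel. indicator {0..2*pi} t * G (cis t)) / (2 * pi)"
    unfolding mahler2_def by (simp add: power2_eq_square)
  have "integrable lborel (\<lambda>s. LINT t|lborel. ?g (s, t))"
    using lborel_pair.integrable_fst'[OF g_int] by simp
  then show "integrable lborel (\<lambda>t. indicator {0..2*pi} t * G (cis t))"
    unfolding inner_eq by simp
qed

section \<open>Reduction to one-dimensional means\<close>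

definition P_mean :: "real \<Rightarrow> real \<Rightarrow> real" where
  "P_mean k u = quadratic_mean \<bar>u - 1\<bar> (k * sqrt u)"

text \<open>The index is shifted: \<open>Q_mean k\<close> belongs to \<open>Q_poly (k + 2)\<close>.
  The second argument carries no absolute value, so it stays affine in \<open>k\<close>;
  \<open>Q_coeff_ge\<close> justifies this.\<close>

definition Q_mean :: "real \<Rightarrow> real \<Rightarrow> real" where
  "Q_mean k u = quadratic_mean \<bar>u - 1\<bar> (u^2 + (k - 2) * u - 2)"

text \<open>The square root lies between 0 and \<open>m = max b (2*a)\<close>, so the argument of
  \<open>ln\<close> lies between \<open>m / 2\<close> and \<open>m\<close>. All later bounds on the
  means reduce to bounds on \<open>m\<close>.\<close>

lemma quadratic_mean_bounds:
  assumes "0 \<le> a" "0 < max b (2*a)"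
  shows "ln (max b (2*a)) - ln 2 \<le> quadratic_mean a b" "quadratic_mean a b \<le> ln (max b (2*a))"
proof -
  define m where "m = max b (2*a)"
  have m: "2 * a \<le> m" "0 < m" using assms by (auto simp: m_def)
  then have "(2 * a)^2 \<le> m^2" using assms(1) by (intro power_mono) auto
  then have s: "0 \<le> sqrt (m^2 - 4 * a^2)" by (simp add: power_mult_distrib)
  have "sqrt (m^2 - 4 * a^2) \<le> sqrt (m^2)" by (rule real_sqrt_le_mono) simp
  then have s': "sqrt (m^2 - 4 * a^2) \<le> m" using m by simp
  have "ln (m / 2) \<le> ln ((m + sqrt (m^2 - 4 * a^2)) / 2)"
    using s m by (intro ln_mono) auto
  then show "ln (max b (2*a)) - ln 2 \<le> quadratic_mean a b"
    using m by (simp add: quadratic_mean_def ln_div flip: m_def)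
  have "ln ((m + sqrt (m^2 - 4 * a^2)) / 2) \<le> ln m"
    using s s' m add_pos_nonneg[OF m(2) s] by (intro ln_mono) auto
  then show "quadratic_mean a b \<le> ln (max b (2*a))"
    by (simp add: quadratic_mean_def flip: m_def)
qed

lemma abs_quadratic_mean_le:
  assumes "0 \<le> a" "0 < d" "d \<le> max b (2*a)" "max b (2*a) \<le> M"
  shows "\<bar>quadratic_mean a b\<bar> \<le> \<bar>ln d - ln 2\<bar> + \<bar>ln M\<bar>"
proof -
  have "ln d \<le> ln (max b (2*a))" "ln (max b (2*a)) \<le> ln M" using assms by (auto intro!: ln_mono)
  then show ?thesis using quadratic_mean_bounds[of a b] assms by linarith
qed

lemma circle_mean_ln_P_poly:
  assumes k: "k \<ge> 4" and x: "cmod x = 1"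
  shows "has_circle_mean (\<lambda>y. ln (cmod (P_poly k x y))) (P_mean k (2 + 2 * Re x))"
proof -
  \<comment> \<open>On the circle \<open>x + 1 = s * (s + cnj s)\<close>, so substituting
    \<open>s * y\<close> for \<open>y\<close> makes all coefficients real up to the common factor
    \<open>s^4\<close>. Either square root would do, as only \<open>\<bar>k * c\<bar>\<close>
    enters.\<close>
  define s where "s = csqrt x"
  define c where "c = 2 * Re s"
  define a where "a = c^2 - 1"
  have sx: "s^2 = x" by (simp add: s_def)
  have "cmod s ^ 2 = 1" using x by (simp flip: norm_power add: sx)
  then have s1: "cmod s = 1" by (simp add: power2_eq_1_iff) (use norm_ge_zero[of s] in linarith)
  then have st: "s * cnj s = 1" by (simp add: complex_norm_square[symmetric])
  have "Re s ^ 2 + Im s ^ 2 = 1" using s1 by (simp add: cmod_def)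
  moreover have "Re x = Re s ^ 2 - Im s ^ 2" by (simp flip: sx add: Re_power2)
  ultimately have u: "c^2 = 2 + 2 * Re x" by (simp add: c_def power_mult_distrib)
  have cc: "complex_of_real c = s + cnj s" by (simp add: c_def complex_add_cnj)
  have "a \<noteq> 0 \<or> k * c \<noteq> 0" using k by (auto simp: a_def)
  from has_circle_mean_rotate[OF circle_mean_quadratic[OF this], of "cnj s"] s1
  have *: "has_circle_mean (\<lambda>y. ln (cmod (of_real a * ((cnj s * y)^2 + 1) + of_real (k * c) * (cnj s * y))))
      (quadratic_mean \<bar>a\<bar> \<bar>k * c\<bar>)" by simp
  have "P_poly k x y = s^4 * (of_real a * ((cnj s * y)^2 + 1) + of_real (k * c) * (cnj s * y))" for y
    using st unfolding P_poly_def sx[symmetric] a_def of_real_mult of_real_diff of_real_power cc of_real_1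
    by algebra
  then have "cmod (P_poly k x y) = cmod (of_real a * ((cnj s * y)^2 + 1) + of_real (k * c) * (cnj s * y))" for y
    by (simp only: norm_mult norm_power s1) simp
  moreover have "quadratic_mean \<bar>a\<bar> \<bar>k * c\<bar> = P_mean k (2 + 2 * Re x)"
    using k by (simp add: P_mean_def a_def flip: u) (simp add: abs_mult)
  ultimately show ?thesis using * by simp
qed

text \<open>The middle coefficient can be negative, but the bound gives \<open>max \<bar>b\<bar> (2
  * \<bar>a\<bar>) = max b (2 * \<bar>a\<bar>)\<close>. For \<open>u \<le> 1\<close> the difference
  of the two sides is \<open>u^2 + (k - 4) * u\<close>, hence \<open>k \<ge> 4\<close>.\<close>

lemma Q_coeff_ge:
  fixes k u :: real
  assumes "k \<ge> 4" "0 \<le> u"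
  shows "- (2 * \<bar>u - 1\<bar>) \<le> u^2 + (k - 2) * u - 2"
proof (cases "u \<le> 1")
  case True
  have "0 \<le> u^2 + (k - 4) * u" using assms by simp
  then show ?thesis using True by (simp add: algebra_simps)
next
  case False
  have "1 \<le> u^2" using False by simp
  moreover have "4 * 1 \<le> k * u" using assms False by (intro mult_mono) auto
  ultimately have "5 \<le> u^2 + k * u" by linarith
  then show ?thesis using False by (simp add: algebra_simps)
qed

lemma circle_mean_ln_Q_poly:
  assumes k: "k \<ge> 4" and x: "cmod x = 1"
  shows "has_circle_mean (\<lambda>y. ln (cmod (Q_poly (k + 2) x y))) (Q_mean k (2 + 2 * Re x))"
proof -
  define u where "u = 2 + 2 * Re x"
  define a where "a = u - 1"
  define b where "b = u^2 + (k - 2) * u - 2"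
  have xt: "x * cnj x = 1" using x by (simp add: complex_norm_square[symmetric])
  have uc: "complex_of_real u = 2 + (x + cnj x)" by (simp add: u_def complex_add_cnj)
  have u0: "0 \<le> u" using abs_Re_le_cmod[of x] x by (simp add: u_def)
  have "a \<noteq> 0 \<or> b \<noteq> 0" using k by (auto simp: a_def b_def)
  from has_circle_mean_rotate[OF circle_mean_quadratic[OF this], of "cnj x"] x
  have *: "has_circle_mean (\<lambda>y. ln (cmod (of_real a * ((cnj x * y)^2 + 1) + of_real b * (cnj x * y))))
      (quadratic_mean \<bar>a\<bar> \<bar>b\<bar>)" by simp
  have "Q_poly (k + 2) x y = x^3 * (of_real a * ((cnj x * y)^2 + 1) + of_real b * (cnj x * y))" for y
    using xt unfolding Q_poly_def a_def b_def of_real_mult of_real_diff of_real_add of_real_power uc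
      of_real_1 of_real_numeral
    by algebra
  then have "cmod (Q_poly (k + 2) x y) = cmod (of_real a * ((cnj x * y)^2 + 1) + of_real b * (cnj x * y))" for y
    by (simp only: norm_mult norm_power x) simp
  moreover have "quadratic_mean \<bar>a\<bar> \<bar>b\<bar> = Q_mean k (2 + 2 * Re x)"
  proof -
    have "max \<bar>b\<bar> (2 * \<bar>a\<bar>) = max b (2 * \<bar>a\<bar>)"
      using Q_coeff_ge[OF k u0] unfolding a_def b_def by linarith
    then show ?thesis by (simp add: Q_mean_def quadratic_mean_def a_def b_def flip: u_def)
  qed
  ultimately show ?thesis using * by simp
qed

section \<open>Bounds uniform over the circle\<close>

lemma P_max_le:
  fixes k u :: real
  assumes "k \<ge> 4" "0 \<le> u" "u \<le> 4"
  shows "max (k * sqrt u) (2 * \<bar>u - 1\<bar>) \<le> 2 * k + 8"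
proof -
  have "sqrt u \<le> sqrt 4" using assms by (intro real_sqrt_le_mono)
  then have "k * sqrt u \<le> k * 2" using assms by (intro mult_left_mono) auto
  then have "k * sqrt u \<le> 2 * k + 8" using assms by linarith
  then show ?thesis using assms by (intro max.boundedI) (simp_all add: abs_if)
qed

lemma Q_max_le:
  fixes k u :: real
  assumes "k \<ge> 4" "0 \<le> u" "u \<le> 4"
  shows "max (u^2 + (k - 2) * u - 2) (2 * \<bar>u - 1\<bar>) \<le> 4 * k + 22"
proof -
  have "u^2 \<le> 4^2" using assms by (intro power_mono)
  moreover have "(k - 2) * u \<le> (k - 2) * 4" using assms by (intro mult_left_mono) auto
  ultimately show ?thesis using assms by (intro max.boundedI) (simp_all add: abs_if)
qed

lemma P_mean_bounded:
  assumes "k \<ge> 4" "0 \<le> u" "u \<le> 4"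
  shows "\<bar>P_mean k u\<bar> \<le> \<bar>ln 1 - ln 2\<bar> + \<bar>ln (2 * k + 8)\<bar>"
proof -
  have "1 \<le> max (k * sqrt u) (2 * \<bar>u - 1\<bar>)"
  proof (cases "u \<le> 1 / 4")
    case False
    then have "sqrt (1 / 4) \<le> sqrt u" by (intro real_sqrt_le_mono) auto
    then have "1 / 2 \<le> sqrt u" by (simp add: real_sqrt_divide)
    then have "4 * (1 / 2) \<le> k * sqrt u" using assms by (intro mult_mono) auto
    then show ?thesis by simp
  qed simp
  then show ?thesis
    unfolding P_mean_def using P_max_le[OF assms] by (intro abs_quadratic_mean_le) auto
qed

lemma Q_mean_bounded:
  assumes "k \<ge> 4" "0 \<le> u" "u \<le> 4"
  shows "\<bar>Q_mean k u\<bar> \<le> \<bar>ln (1 / 5) - ln 2\<bar> + \<bar>ln (4 * k + 22)\<bar>"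
proof -
  let ?b = "u^2 + (k - 2) * u - 2"
  have "1 / 5 \<le> max ?b (2 * \<bar>u - 1\<bar>)"
  \<comment> \<open>\<open>2 * \<bar>u - 1\<bar>\<close> degenerates only near \<open>u = 1\<close>,
    where \<open>?b\<close> takes over: beyond \<open>9 / 10\<close> it is at least
    \<open>81/100 + 9/5 - 2\<close>.\<close>
  proof (cases "u \<le> 9 / 10")
    case False
    have "(9 / 10)^2 \<le> u^2" using False by (intro power_mono) auto
    moreover have "2 * (9 / 10) \<le> (k - 2) * u" using assms False by (intro mult_mono) auto
    ultimately have "1 / 5 \<le> ?b" by (simp add: power2_eq_square)
    then show ?thesis by (rule max.coboundedI1)
  next
    case True
    then have "1 / 5 \<le> 2 * \<bar>u - 1\<bar>" by simp
    then show ?thesis by (rule max.coboundedI2)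
  qed
  then show ?thesis
    unfolding Q_mean_def using Q_max_le[OF assms] by (intro abs_quadratic_mean_le) auto
qed

lemma mahler2_P_poly:
  assumes "k \<ge> 4"
  shows "mahler2 (P_poly k) = (LINT t|lborel. indicator {0..2*pi} t * P_mean k (2 + 2 * cos t)) / (2 * pi)"
    and "integrable lborel (\<lambda>t. indicator {0..2*pi} t * P_mean k (2 + 2 * cos t))"
proof -
  have cont: "continuous_on UNIV (\<lambda>p. P_poly k (fst p) (snd p))"
    unfolding P_poly_def by (intro continuous_intros)
  have B: "\<bar>P_mean k (2 + 2 * Re x)\<bar> \<le> \<bar>ln 1 - ln 2\<bar> + \<bar>ln (2 * k + 8)\<bar>" if "cmod x = 1" for x
    using abs_Re_le_cmod[of x] that assms by (intro P_mean_bounded) auto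
  show "mahler2 (P_poly k) = (LINT t|lborel. indicator {0..2*pi} t * P_mean k (2 + 2 * cos t)) / (2 * pi)"
    and "integrable lborel (\<lambda>t. indicator {0..2*pi} t * P_mean k (2 + 2 * cos t))"
    using mahler2_eq_integral_circle_mean[of "P_poly k", OF cont circle_mean_ln_P_poly[OF assms] B]
    by simp_all
qed

lemma mahler2_Q_poly:
  assumes "k \<ge> 4"
  shows "mahler2 (Q_poly (k + 2)) = (LINT t|lborel. indicator {0..2*pi} t * Q_mean k (2 + 2 * cos t)) / (2 * pi)"
    and "integrable lborel (\<lambda>t. indicator {0..2*pi} t * Q_mean k (2 + 2 * cos t))"
proof -
  have cont: "continuous_on UNIV (\<lambda>p. Q_poly (k + 2) (fst p) (snd p))"
    unfolding Q_poly_def by (intro continuous_intros)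
  have B: "\<bar>Q_mean k (2 + 2 * Re x)\<bar> \<le> \<bar>ln (1 / 5) - ln 2\<bar> + \<bar>ln (4 * k + 22)\<bar>" if "cmod x = 1" for x
    using abs_Re_le_cmod[of x] that assms by (intro Q_mean_bounded) auto
  show "mahler2 (Q_poly (k + 2)) = (LINT t|lborel. indicator {0..2*pi} t * Q_mean k (2 + 2 * cos t)) / (2 * pi)"
    and "integrable lborel (\<lambda>t. indicator {0..2*pi} t * Q_mean k (2 + 2 * cos t))"
    using mahler2_eq_integral_circle_mean[of "Q_poly (k + 2)", OF cont circle_mean_ln_Q_poly[OF assms] B]
    by simp_all
qed

section \<open>The derivative in the parameter\<close>

text \<open>Zero while both roots lie on the unit circle. For \<open>0 < a\<close> the value at
  \<open>b = 2 * a\<close> is a convention, since the graph of the mean has a vertical tangent from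
  the right there.\<close>

definition mean_deriv :: "real \<Rightarrow> real \<Rightarrow> real" where
  "mean_deriv a b = (if b > 2 * a then 1 / sqrt (b^2 - 4 * a^2) else 0)"

definition P_deriv :: "real \<Rightarrow> real \<Rightarrow> real" where
  "P_deriv k u = sqrt u * mean_deriv \<bar>u - 1\<bar> (k * sqrt u)"

definition Q_deriv :: "real \<Rightarrow> real \<Rightarrow> real" where
  "Q_deriv k u = u * mean_deriv \<bar>u - 1\<bar> (u^2 + (k - 2) * u - 2)"

lemma four_sq_less_sq:
  fixes a b :: real
  assumes "0 \<le> a" "2 * a < b"
  shows "0 < b^2 - 4 * a^2"
  using power_strict_mono[of "2*a" b 2] assms by (simp add: power_mult_distrib)

lemma mean_deriv_nonneg: "0 \<le> a \<Longrightarrow> 0 \<le> mean_deriv a b"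
  using four_sq_less_sq[of a b] by (auto simp: mean_deriv_def)

text \<open>Beyond \<open>2 * a\<close> the mean is \<open>ln a + arcosh (b / (2 * a))\<close>;
  before it, the mean is constant.\<close>

lemma quadratic_mean_has_real_derivative:
  assumes a: "0 < a" and b: "b \<noteq> 2 * a"
  shows "(quadratic_mean a has_real_derivative mean_deriv a b) (at b)"
proof (cases "b > 2 * a")
  case True
  define q where "q = sqrt (b^2 - 4 * a^2)"
  have q: "0 < b^2 - 4 * a^2" using four_sq_less_sq True a by simp
  then have q0: "0 < q" by (simp add: q_def)
  have "((\<lambda>b. b + sqrt (b^2 - 4 * a^2)) has_real_derivative 1 + inverse q / 2 * (2 * b)) (at b)"
    unfolding q_def using q by (auto intro!: derivative_eq_intros)
  then have der: "((\<lambda>b. (b + sqrt (b^2 - 4 * a^2)) / 2) has_real_derivative (1 + inverse q / 2 * (2 * b)) / 2) (at b)"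
    by (rule DERIV_cdivide)
  have pos: "0 < (b + sqrt (b^2 - 4 * a^2)) / 2" using q0 True a by (simp flip: q_def)
  have "((\<lambda>b. ln ((b + sqrt (b^2 - 4 * a^2)) / 2)) has_real_derivative
      1 / ((b + q) / 2) * ((1 + inverse q / 2 * (2 * b)) / 2)) (at b)"
    using DERIV_chain2[where f=ln and g="\<lambda>b. (b + sqrt (b^2 - 4 * a^2)) / 2", OF DERIV_ln_divide[OF pos] der]
    by (simp only: q_def)
  also have "1 / ((b + q) / 2) * ((1 + inverse q / 2 * (2 * b)) / 2) = mean_deriv a b"
    using q0 True a by (simp add: mean_deriv_def divide_simps flip: q_def)
  finally show ?thesis
    by (rule has_field_derivative_transform_within_open[where S="{2*a<..}"])
       (use True in \<open>auto simp: quadratic_mean_def\<close>)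
next
  case False
  have "((\<lambda>_. quadratic_mean a (2 * a)) has_real_derivative 0) (at b)" by simp
  then have "(quadratic_mean a has_real_derivative 0) (at b)"
    by (rule has_field_derivative_transform_within_open[where S="{..<2*a}"])
       (use False b in \<open>auto simp: quadratic_mean_def\<close>)
  then show ?thesis using False by (simp add: mean_deriv_def)
qed

lemma continuous_on_quadratic_mean:
  assumes "0 < a"
  shows "continuous_on S (quadratic_mean a)"
proof -
  have "0 < max x (2 * a) + sqrt ((max x (2 * a))^2 - 4 * a^2)" for x
  proof -
    have "(2 * a)^2 \<le> (max x (2 * a))^2" using assms by (intro power_mono) auto
    then show ?thesis using assms by (intro add_pos_nonneg) (auto simp: power_mult_distrib)
  qed
  then show ?thesis unfolding quadratic_mean_def[abs_def]
    by (intro continuous_intros) (auto simp: less_imp_neq[symmetric])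
qed

text \<open>The antiderivative is continuous and differentiable except where
  \<open>c * x + d = 2 * a\<close>, and the fundamental theorem tolerates this one point.
  Nonnegativity turns the gauge integral of the unbounded integrand into a Lebesgue
  integral.\<close>

lemma nn_integral_mean_deriv:
  assumes a: "0 < a" and c: "0 < c" and "k \<le> K"
  shows "(\<integral>\<^sup>+x. ennreal (indicator {k..K} x * (c * mean_deriv a (c * x + d))) \<partial>lborel)
    = ennreal (quadratic_mean a (c * K + d) - quadratic_mean a (c * k + d))"
proof (rule nn_integral_has_integral_lborel)
  have [measurable]: "(\<lambda>x. mean_deriv a (c * x + d)) \<in> borel_measurable borel"
    unfolding mean_deriv_def by measurable
  show "(\<lambda>x. indicator {k..K} x * (c * mean_deriv a (c * x + d))) \<in> borel_measurable borel"
    by measurable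
  show "0 \<le> indicator {k..K} x * (c * mean_deriv a (c * x + d))" for x
    using a c mean_deriv_nonneg by simp
  have "((\<lambda>x. c * mean_deriv a (c * x + d)) has_integral
      quadratic_mean a (c * K + d) - quadratic_mean a (c * k + d)) {k..K}"
  proof (rule fundamental_theorem_of_calculus_strong[where S="{(2 * a - d) / c}"])
    show "((\<lambda>x. quadratic_mean a (c * x + d)) has_vector_derivative c * mean_deriv a (c * x + d)) (at x)"
      if "x \<in> {k..K} - {(2 * a - d) / c}" for x
    proof -
      have "c * x + d \<noteq> 2 * a" using that c by (auto simp: field_simps)
      have "((\<lambda>x. c * x + d) has_real_derivative c) (at x)" by (auto intro!: derivative_eq_intros)
      from DERIV_chain2[where f="quadratic_mean a", OF quadratic_mean_has_real_derivative[OF a \<open>c * x + d \<noteq> 2 * a\<close>] this]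
      have "((\<lambda>x. quadratic_mean a (c * x + d)) has_real_derivative mean_deriv a (c * x + d) * c) (at x)" .
      then show ?thesis by (simp add: has_real_derivative_iff_has_vector_derivative mult.commute)
    qed
    show "continuous_on {k..K} (\<lambda>x. quadratic_mean a (c * x + d))"
      by (rule continuous_on_compose2[OF continuous_on_quadratic_mean[OF a, of UNIV]])
         (auto intro!: continuous_intros)
  qed (use assms in auto)
  then have "((\<lambda>x. if x \<in> {k..K} then c * mean_deriv a (c * x + d) else 0) has_integral
      quadratic_mean a (c * K + d) - quadratic_mean a (c * k + d)) UNIV"
    by (simp only: has_integral_restrict_UNIV)
  moreover have "(\<lambda>x. if x \<in> {k..K} then c * mean_deriv a (c * x + d) else 0)
      = (\<lambda>x. indicator {k..K} x * (c * mean_deriv a (c * x + d)))"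
    by (auto simp: fun_eq_iff indicator_def)
  ultimately show "((\<lambda>x. indicator {k..K} x * (c * mean_deriv a (c * x + d))) has_integral
      quadratic_mean a (c * K + d) - quadratic_mean a (c * k + d)) UNIV" by simp
qed

lemma nn_integral_P_deriv:
  assumes "0 < u" "u \<noteq> 1" "k \<le> K"
  shows "(\<integral>\<^sup>+x. ennreal (indicator {k..K} x * P_deriv x u) \<partial>lborel) = ennreal (P_mean K u - P_mean k u)"
  using nn_integral_mean_deriv[of "\<bar>u - 1\<bar>" "sqrt u" k K 0] assms
  by (simp add: P_deriv_def P_mean_def mult.commute)

lemma nn_integral_Q_deriv:
  assumes "0 < u" "u \<noteq> 1" "k \<le> K"
  shows "(\<integral>\<^sup>+x. ennreal (indicator {k..K} x * Q_deriv x u) \<partial>lborel) = ennreal (Q_mean K u - Q_mean k u)"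
proof -
  have eq: "u^2 + (x - 2) * u - 2 = u * x + (u^2 - 2 * u - 2)" for x by (simp add: algebra_simps)
  show ?thesis
    unfolding Q_deriv_def Q_mean_def eq by (rule nn_integral_mean_deriv) (use assms in auto)
qed

section \<open>Elliptic integrals in the variable \<open>u\<close>\<close>

text \<open>For \<open>u = 2 + 2 cos t\<close> one has \<open>u * (4 - u) = (2 sin t)^2\<close>.
  Each half circle covers \<open>{0..4}\<close> once. The substitution is done on
  \<open>{pi..2*pi}\<close>, where \<open>u\<close> increases, and the reflection
  \<open>2 * pi - t\<close> gives the other half.\<close>

lemma nn_integral_circle_substitution:
  fixes f :: "real \<Rightarrow> real"
  assumes [measurable]: "f \<in> borel_measurable borel" and f0: "\<And>u. 0 \<le> u \<Longrightarrow> 0 \<le> f u"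
  shows "(\<integral>\<^sup>+t. ennreal (indicator {0..2*pi} t * f (2 + 2 * cos t)) \<partial>lborel)
    = 2 * (\<integral>\<^sup>+u. ennreal (f u / sqrt (u * (4 - u))) * indicator {0..4} u \<partial>lborel)"
proof -
  let ?I = "\<integral>\<^sup>+u. ennreal (f u / sqrt (u * (4 - u))) * indicator {0..4} u \<partial>lborel"
  let ?h = "\<lambda>a b t. ennreal (indicator {a..b} t * f (2 + 2 * cos t))"
  have [measurable]: "(\<lambda>t. f (2 + 2 * cos t)) \<in> borel_measurable borel"
    by (rule measurable_compose[OF _ assms(1)]) (intro borel_measurable_continuous_onI continuous_intros)
  have h_meas [measurable]: "?h a b \<in> borel_measurable borel" for a b
    by measurable
  have neg_sin: "0 \<le> - sin t" if "t \<in> {pi..2*pi}" for t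
    using sin_ge_zero[of "t - pi"] that by simp
  have upper: "?I = (\<integral>\<^sup>+t. ?h pi (2*pi) t \<partial>lborel)"
  proof -
    have "(\<integral>\<^sup>+u. ennreal (f u / sqrt (u * (4 - u))) * indicator {2 + 2 * cos pi..2 + 2 * cos (2*pi)} u \<partial>lborel)
        = (\<integral>\<^sup>+t. ennreal (f (2 + 2 * cos t) / sqrt ((2 + 2 * cos t) * (4 - (2 + 2 * cos t)))) * ennreal (- 2 * sin t) * indicator {pi..2*pi} t \<partial>lborel)"
      by (rule nn_integral_substitution_aux)
         (use neg_sin in \<open>auto intro!: derivative_eq_intros continuous_intros\<close>)
    also have "\<dots> = (\<integral>\<^sup>+t. ?h pi (2*pi) t \<partial>lborel)"
    proof (rule nn_integral_cong_AE)
      \<comment> \<open>At these points the square root vanishes and division by it yields 0, so the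
        integrands may differ.\<close>
      have "AE t in lborel. t \<notin> {pi, 2*pi}"
        by (intro AE_not_in finite_imp_null_set_lborel) simp
      then show "AE t in lborel. ennreal (f (2 + 2 * cos t) / sqrt ((2 + 2 * cos t) * (4 - (2 + 2 * cos t)))) * ennreal (- 2 * sin t) * indicator {pi..2*pi} t
          = ?h pi (2*pi) t"
      proof eventually_elim
        case (elim t)
        show ?case
        proof (cases "t \<in> {pi..2*pi}")
          case True
          then have "0 < sin (t - pi)" using elim by (intro sin_gt_zero) auto
          then have s: "0 < - 2 * sin t" by simp
          have "(2 + 2 * cos t) * (4 - (2 + 2 * cos t)) = 4 - 4 * (cos t)^2"
            by (simp add: algebra_simps power2_eq_square)
          also have "\<dots> = (- 2 * sin t)^2"
            by (simp add: power_mult_distrib cos_squared_eq)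
          finally have "sqrt ((2 + 2 * cos t) * (4 - (2 + 2 * cos t))) = \<bar>- 2 * sin t\<bar>"
            by (simp only: real_sqrt_abs)
          then have "sqrt ((2 + 2 * cos t) * (4 - (2 + 2 * cos t))) = - 2 * sin t"
            by (simp only: abs_of_pos[OF s])
          then have "ennreal (f (2 + 2 * cos t) / sqrt ((2 + 2 * cos t) * (4 - (2 + 2 * cos t)))) * ennreal (- 2 * sin t)
              = ennreal (f (2 + 2 * cos t) / (- 2 * sin t)) * ennreal (- 2 * sin t)" by simp
          also have "\<dots> = ennreal (f (2 + 2 * cos t) / (- 2 * sin t) * (- 2 * sin t))"
            by (rule ennreal_mult''[symmetric]) (use s in simp)
          also have "\<dots> = ennreal (f (2 + 2 * cos t))" using s by simp
          finally show ?thesis using True by simp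
        qed simp
      qed
    qed
    finally show ?thesis by simp
  qed
  have "(\<integral>\<^sup>+t. ?h 0 pi t \<partial>lborel) = ennreal \<bar>-1\<bar> * (\<integral>\<^sup>+t. ?h 0 pi (2*pi + (-1) * t) \<partial>lborel)"
    by (rule nn_integral_real_affine[OF h_meas]) simp
  also have "(\<lambda>t. ?h 0 pi (2*pi + (-1) * t)) = ?h pi (2*pi)"
    by (auto simp: fun_eq_iff indicator_def)
  finally have lower: "(\<integral>\<^sup>+t. ?h 0 pi t \<partial>lborel) = ?I" using upper by simp
  have "(\<integral>\<^sup>+t. ?h 0 (2*pi) t \<partial>lborel) = (\<integral>\<^sup>+t. ?h 0 pi t + ?h pi (2*pi) t \<partial>lborel)"
  proof (rule nn_integral_cong_AE)
    have "AE t in lborel. t \<notin> {pi}"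
      by (intro AE_not_in finite_imp_null_set_lborel) simp
    then show "AE t in lborel. ?h 0 (2*pi) t = ?h 0 pi t + ?h pi (2*pi) t"
      by eventually_elim (auto simp: indicator_def)
  qed
  also have "\<dots> = (\<integral>\<^sup>+t. ?h 0 pi t \<partial>lborel) + (\<integral>\<^sup>+t. ?h pi (2*pi) t \<partial>lborel)"
    by (rule nn_integral_add) (use h_meas in simp_all)
  also have "\<dots> = ?I + ?I" by (simp only: lower upper[symmetric])
  finally show ?thesis by (simp only: mult_2)
qed

text \<open>The Moebius transformation \<open>M t = ((k + 1) * t - 4) / (t + k - 4)\<close> fixes \<open>4\<close> and pulls the
  holomorphic differential of the elliptic curve \<open>w\<^sup>2 = (4 - u) (k\<^sup>2 u - 4 (u - 1)\<^sup>2)\<close> back to that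
  of \<open>w\<^sup>2 = (4 - t) (t + k - 4) (t\<^sup>2 + k t - 4)\<close>.\<close>

lemma deriv_moebius:
  fixes k t :: real
  assumes k: "4 < k" and t: "0 < t" "t < 4"
  defines "D \<equiv> t + k - 4"
  defines "M \<equiv> ((k + 1) * t - 4) / D"
  shows "P_deriv k M / sqrt (M * (4 - M)) * (k * (k - 3) / D^2) = Q_deriv k t / sqrt (t * (4 - t))"
proof -
  define w where "w = t^2 + k * t - 4"
  have D: "0 < D" using k t by (simp add: D_def)
  have M4: "4 - M = (k - 3) * (4 - t) / D"
    using D by (simp add: M_def field_simps) (simp add: D_def algebra_simps)
  have M1: "M - 1 = k * (t - 1) / D"
    using D by (simp add: M_def field_simps) (simp add: D_def algebra_simps)
  have "k^2 * M - 4 * (M - 1)^2 = k^2 * (((k + 1) * t - 4) * D - 4 * (t - 1)^2) / D^2"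
    unfolding M1 using D by (simp add: M_def field_simps power2_eq_square)
  also have "((k + 1) * t - 4) * D - 4 * (t - 1)^2 = (k - 3) * w"
    by (simp add: D_def w_def algebra_simps power2_eq_square)
  finally have disc: "k^2 * M - 4 * (M - 1)^2 = k^2 * ((k - 3) * w) / D^2" .
  \<comment> \<open>Valid for negative \<open>M\<close> too, because \<open>sqrt\<close> is an odd
    function; \<open>M\<close> is negative for small \<open>t\<close>.\<close>
  have ksqrt: "k * sqrt M = sqrt (k^2 * M)" using k by (simp add: real_sqrt_mult)
  have asqrt: "2 * \<bar>M - 1\<bar> = sqrt (4 * (M - 1)^2)" by (simp add: real_sqrt_mult)
  have P_iff: "2 * \<bar>M - 1\<bar> < k * sqrt M \<longleftrightarrow> 0 < w"
  proof -
    have "2 * \<bar>M - 1\<bar> < k * sqrt M \<longleftrightarrow> 0 < k^2 * M - 4 * (M - 1)^2"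
      unfolding ksqrt asqrt by simp
    also have "\<dots> \<longleftrightarrow> 0 < w" unfolding disc using k D by (simp add: zero_less_mult_iff zero_less_divide_iff)
    finally show ?thesis .
  qed
  have tD: "0 < t * D" using t D by simp
  \<comment> \<open>These are the factors of \<open>b^2 - 4 a^2\<close> for \<open>Q\<close>. The
    first is positive on the interval, so \<open>w\<close> alone decides whether the roots leave the
    circle, as it does for \<open>P\<close> by \<open>P_iff\<close>.\<close>
  have b1: "t^2 + (k - 2) * t - 2 - 2 * (t - 1) = t * D" "t^2 + (k - 2) * t - 2 - 2 * (1 - t) = w"
    by (simp_all add: D_def w_def algebra_simps power2_eq_square)
  have abs_less: "2 * \<bar>t - 1\<bar> < b \<longleftrightarrow> 0 < b - 2 * (t - 1) \<and> 0 < b - 2 * (1 - t)" for b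
    by (auto simp: abs_if)
  have Q_iff: "2 * \<bar>t - 1\<bar> < t^2 + (k - 2) * t - 2 \<longleftrightarrow> 0 < w"
    unfolding abs_less b1 using tD by simp
  show ?thesis
  proof (cases "0 < w")
    case False
    then show ?thesis using P_iff Q_iff by (simp add: P_deriv_def Q_deriv_def mean_deriv_def)
  next
    case w: True
    have "0 < k^2 * ((k - 3) * w) / D^2" using k w D by simp
    then have "0 < k^2 * M" using disc zero_le_power2[of "M - 1"] by linarith
    then have M0: "0 < M" using k by (simp add: zero_less_mult_iff)
    \<comment> \<open>The quartic of the target curve; both sides turn out to be
      \<open>1 / sqrt X\<close>.\<close>
    define X where "X = w * D * (4 - t)"
    have X: "0 < X" using w D t by (simp add: X_def)
    have "P_deriv k M / sqrt (M * (4 - M)) = sqrt M / (sqrt ((k * sqrt M)^2 - 4 * (M - 1)^2) * sqrt (M * (4 - M)))"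
      using P_iff w by (simp add: P_deriv_def mean_deriv_def)
    also have "(k * sqrt M)^2 - 4 * (M - 1)^2 = k^2 * ((k - 3) * w) / D^2"
      using disc M0 by (simp add: power_mult_distrib)
    also have "sqrt M / (sqrt X * sqrt (M * (4 - M))) = 1 / sqrt (X * (4 - M))" for X
      using M0 by (simp add: real_sqrt_mult)
    also have "k^2 * ((k - 3) * w) / D^2 * (4 - M) = (k * (k - 3) / D^2)^2 * X"
      unfolding M4 X_def using D by (simp add: field_simps power2_eq_square)
    also have "sqrt ((k * (k - 3) / D^2)^2 * X) = k * (k - 3) / D^2 * sqrt X"
      using k D by (simp add: real_sqrt_mult)
    finally have P: "P_deriv k M / sqrt (M * (4 - M)) * (k * (k - 3) / D^2) = 1 / sqrt X"
      using k D by simp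
    have "Q_deriv k t / sqrt (t * (4 - t)) = t / (sqrt ((t^2 + (k - 2) * t - 2)^2 - 4 * (t - 1)^2) * sqrt (t * (4 - t)))"
      using Q_iff w by (simp add: Q_deriv_def mean_deriv_def)
    also have "(t^2 + (k - 2) * t - 2)^2 - 4 * (t - 1)^2
        = (t^2 + (k - 2) * t - 2 - 2 * (t - 1)) * (t^2 + (k - 2) * t - 2 - 2 * (1 - t))"
      by (simp add: algebra_simps power2_eq_square)
    also have "\<dots> = t * D * w" unfolding b1 ..
    also have "sqrt (t * D * w) * sqrt (t * (4 - t)) = sqrt (t^2 * X)"
      by (simp add: X_def power2_eq_square mult_ac flip: real_sqrt_mult)
    also have "\<dots> = t * sqrt X" using t by (simp add: real_sqrt_mult)
    finally show ?thesis using P t by simp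
  qed
qed

lemma P_deriv_nonneg: "0 \<le> u \<Longrightarrow> 0 \<le> P_deriv k u"
  by (simp add: P_deriv_def mean_deriv_nonneg)

lemma Q_deriv_nonneg: "0 \<le> u \<Longrightarrow> 0 \<le> Q_deriv k u"
  by (simp add: Q_deriv_def mean_deriv_nonneg)

lemma measurable_P_deriv [measurable]:
  assumes [measurable]: "f \<in> borel_measurable M" "g \<in> borel_measurable M"
  shows "(\<lambda>x. P_deriv (f x) (g x)) \<in> borel_measurable M"
  unfolding P_deriv_def mean_deriv_def by measurable

lemma measurable_Q_deriv [measurable]:
  assumes [measurable]: "f \<in> borel_measurable M" "g \<in> borel_measurable M"
  shows "(\<lambda>x. Q_deriv (f x) (g x)) \<in> borel_measurable M"
  unfolding Q_deriv_def mean_deriv_def by measurable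

text \<open>The Moebius map sends \<open>{0..4}\<close> to an interval from
  \<open>M 0 = - 4 / (k - 4)\<close> to \<open>4\<close>. Extending the left integral below 0 costs
  nothing because \<open>P_deriv k\<close> vanishes there. At \<open>k = 4\<close> the map would
  have its pole at the endpoint 0.\<close>

lemma nn_integral_deriv_eq:
  assumes k: "4 < k"
  shows "(\<integral>\<^sup>+u. ennreal (P_deriv k u / sqrt (u * (4 - u))) * indicator {0..4} u \<partial>lborel)
    = (\<integral>\<^sup>+u. ennreal (Q_deriv k u / sqrt (u * (4 - u))) * indicator {0..4} u \<partial>lborel)"
proof -
  define M where "M t = ((k + 1) * t - 4) / (t + k - 4)" for t
  define M' where "M' t = k * (k - 3) / (t + k - 4)^2" for t
  let ?f = "\<lambda>u. ennreal (P_deriv k u / sqrt (u * (4 - u)))"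
  have P0: "P_deriv k u = 0" if "u \<le> 0" for u
  proof (cases "u = 0")
    case False
    then have "k * sqrt u < 0" using that k by (simp add: mult_less_0_iff)
    then have "k * sqrt u \<le> 2 * \<bar>u - 1\<bar>" by (rule order_trans[OF less_imp_le]) simp
    then have "\<not> 2 * \<bar>u - 1\<bar> < k * sqrt u" by (simp only: not_less)
    then show ?thesis by (simp add: P_deriv_def mean_deriv_def)
  qed (simp add: P_deriv_def)
  have "M 0 \<le> 0" using k by (simp add: M_def)
  have "M 4 = 4" using k by (simp add: M_def)
  have "(\<integral>\<^sup>+u. ?f u * indicator {0..4} u \<partial>lborel) = (\<integral>\<^sup>+u. ?f u * indicator {M 0..M 4} u \<partial>lborel)"
    by (rule nn_integral_cong) (use P0 \<open>M 0 \<le> 0\<close> \<open>M 4 = 4\<close> in \<open>auto simp: indicator_def\<close>)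
  also have "\<dots> = (\<integral>\<^sup>+t. ?f (M t) * ennreal (M' t) * indicator {0..4} t \<partial>lborel)"
  proof (rule nn_integral_substitution_aux)
    show "(M has_real_derivative M' t) (at t)" if "t \<in> {0..4}" for t
    proof -
      have D: "t + k - 4 \<noteq> 0" using that k by auto
      have "((\<lambda>t. ((k + 1) * t - 4) / (t + k - 4)) has_real_derivative
          ((k + 1) * (t + k - 4) - ((k + 1) * t - 4) * 1) / ((t + k - 4) * (t + k - 4))) (at t)"
        by (rule derivative_eq_intros refl)+ (use D in auto)
      also have "(k + 1) * (t + k - 4) - ((k + 1) * t - 4) * 1 = k * (k - 3)" by (simp add: algebra_simps)
      finally show ?thesis by (simp add: M_def[abs_def] M'_def power2_eq_square)
    qed
    show "continuous_on {0..4} M'"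
      unfolding M'_def[abs_def] by (intro continuous_intros) (use k in auto)
  qed (use k in \<open>auto simp: M'_def\<close>)
  also have "\<dots> = (\<integral>\<^sup>+u. ennreal (Q_deriv k u / sqrt (u * (4 - u))) * indicator {0..4} u \<partial>lborel)"
  proof (rule nn_integral_cong_AE)
    have "AE t in lborel. (t::real) \<notin> {0, 4}"
      by (intro AE_not_in finite_imp_null_set_lborel) simp
    then show "AE t in lborel. ?f (M t) * ennreal (M' t) * indicator {0..4} t
        = ennreal (Q_deriv k t / sqrt (t * (4 - t))) * indicator {0..4} t"
    proof eventually_elim
      case (elim t)
      show ?case
      proof (cases "t \<in> {0..4}")
        case True
        have "?f (M t) * ennreal (M' t) = ennreal (P_deriv k (M t) / sqrt (M t * (4 - M t)) * M' t)"
          by (rule ennreal_mult''[symmetric]) (use k in \<open>simp add: M'_def\<close>)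
        also have "\<dots> = ennreal (Q_deriv k t / sqrt (t * (4 - t)))"
          using deriv_moebius[OF k, of t] True elim by (simp add: M_def M'_def)
        finally show ?thesis by simp
      qed simp
    qed
  qed
  finally show ?thesis .
qed

lemma nn_integral_circle_deriv_eq:
  assumes "4 < k"
  shows "(\<integral>\<^sup>+t. ennreal (indicator {0..2*pi} t * P_deriv k (2 + 2 * cos t)) \<partial>lborel)
    = (\<integral>\<^sup>+t. ennreal (indicator {0..2*pi} t * Q_deriv k (2 + 2 * cos t)) \<partial>lborel)"
proof -
  have [measurable]: "P_deriv k \<in> borel_measurable borel" "Q_deriv k \<in> borel_measurable borel"
    using measurable_P_deriv[of "\<lambda>_. k" borel id] measurable_Q_deriv[of "\<lambda>_. k" borel id]
    by (simp_all add: id_def)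
  show ?thesis
    using nn_integral_circle_substitution[of "P_deriv k"] nn_integral_circle_substitution[of "Q_deriv k"]
      nn_integral_deriv_eq[OF assms]
    by (simp only: P_deriv_nonneg Q_deriv_nonneg \<open>P_deriv k \<in> _\<close> \<open>Q_deriv k \<in> _\<close> simp_thms)
qed

section \<open>Comparison of the two means\<close>

lemma AE_cos_neq:
  fixes c :: real
  shows "AE t in lborel. cos t \<noteq> c"
proof -
  have "{t. cos t = c} \<subseteq> {t. cis t = Complex c (sqrt (1 - c^2))} \<union> {t. cis t = Complex c (- sqrt (1 - c^2))}"
  proof
    fix t assume "t \<in> {t. cos t = c}"
    then have c: "cos t = c" by simp
    then have "sqrt (1 - c^2) = \<bar>sin t\<bar>" using sin_squared_eq[of t] by (metis real_sqrt_abs)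
    then have "sin t = sqrt (1 - c^2) \<or> sin t = - sqrt (1 - c^2)" by linarith
    with c show "t \<in> {t. cis t = Complex c (sqrt (1 - c^2))} \<union> {t. cis t = Complex c (- sqrt (1 - c^2))}"
      by (auto simp: complex_eq_iff)
  qed
  then have "countable {t. cos t = c}"
    using countable_cis_eq countable_Un countable_subset by meson
  from AE_not_in[OF countable_imp_null_set_lborel[OF this]] show ?thesis by simp
qed

text \<open>At \<open>u = 0\<close> the slope of \<open>b\<close> in \<open>k\<close> for
  \<open>P\<close> and the factor \<open>u\<close> for \<open>Q\<close> vanish; at
  \<open>u = 1\<close> the coefficient \<open>a\<close> does. These are \<open>cos t = -1\<close>
  and \<open>cos t = -1/2\<close>.\<close>

lemma AE_circle_generic:
  assumes "\<And>u::real. 0 < u \<Longrightarrow> u \<le> 4 \<Longrightarrow> u \<noteq> 1 \<Longrightarrow> R u"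
  shows "AE t in lborel. R (2 + 2 * cos t)"
  using AE_cos_neq[of "-1"] AE_cos_neq[of "-1/2"]
proof eventually_elim
  case (elim t)
  have "- 1 < cos t" using elim cos_ge_minus_one[of t] by linarith
  with elim show ?case by (intro assms) auto
qed

lemma quadratic_mean_mono:
  assumes "0 < a" "b \<le> c"
  shows "quadratic_mean a b \<le> quadratic_mean a c"
proof -
  define m n where "m = max b (2 * a)" and "n = max c (2 * a)"
  have mn: "2 * a \<le> m" "m \<le> n" using assms by (auto simp: m_def n_def)
  have "(2 * a)^2 \<le> m^2" using mn assms by (intro power_mono) auto
  then have "0 \<le> sqrt (m^2 - 4 * a^2)" by (simp add: power_mult_distrib)
  moreover have "m^2 \<le> n^2" using mn assms by (intro power_mono) auto
  then have "sqrt (m^2 - 4 * a^2) \<le> sqrt (n^2 - 4 * a^2)" by simp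
  with mn have "(m + sqrt (m^2 - 4 * a^2)) / 2 \<le> (n + sqrt (n^2 - 4 * a^2)) / 2"
    by (intro divide_right_mono add_mono) simp_all
  ultimately have "ln ((m + sqrt (m^2 - 4 * a^2)) / 2) \<le> ln ((n + sqrt (n^2 - 4 * a^2)) / 2)"
    using mn assms add_pos_nonneg[of m "sqrt (m^2 - 4 * a^2)"] by (intro ln_mono) simp_all
  then show ?thesis by (simp add: quadratic_mean_def flip: m_def n_def)
qed

lemma P_mean_mono: "0 < u \<Longrightarrow> u \<noteq> 1 \<Longrightarrow> k \<le> K \<Longrightarrow> P_mean k u \<le> P_mean K u"
  unfolding P_mean_def by (intro quadratic_mean_mono mult_right_mono) auto

lemma Q_mean_mono: "0 < u \<Longrightarrow> u \<noteq> 1 \<Longrightarrow> k \<le> K \<Longrightarrow> Q_mean k u \<le> Q_mean K u"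
  unfolding Q_mean_def by (intro quadratic_mean_mono diff_mono add_mono mult_right_mono) auto

text \<open>Tonelli replaces differentiation under the integral sign: extended nonnegative integrals
  may be swapped without knowing them finite.\<close>

lemma nn_integral_circle_increment:
  fixes D G :: "real \<Rightarrow> real \<Rightarrow> real"
  assumes [measurable]: "(\<lambda>p. D (fst p) (2 + 2 * cos (snd p))) \<in> borel_measurable (borel \<Otimes>\<^sub>M borel)"
    and D: "\<And>u. 0 < u \<Longrightarrow> u \<noteq> 1 \<Longrightarrow>
      (\<integral>\<^sup>+x. ennreal (indicator {k..K} x * D x u) \<partial>lborel) = ennreal (G K u - G k u)"
  shows "(\<integral>\<^sup>+t. ennreal (indicator {0..2*pi} t * (G K (2 + 2 * cos t) - G k (2 + 2 * cos t))) \<partial>lborel)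
    = (\<integral>\<^sup>+x. indicator {k..K} x * (\<integral>\<^sup>+t. ennreal (indicator {0..2*pi} t * D x (2 + 2 * cos t)) \<partial>lborel) \<partial>lborel)"
    (is "?L = ?R")
proof -
  let ?f = "\<lambda>x t. ennreal (indicator {k..K} x * (indicator {0..2*pi} t * D x (2 + 2 * cos t)))"
  have meas: "case_prod ?f \<in> borel_measurable (lborel \<Otimes>\<^sub>M lborel)"
    unfolding case_prod_unfold by measurable
  have "?L = (\<integral>\<^sup>+t. (\<integral>\<^sup>+x. ?f x t \<partial>lborel) \<partial>lborel)"
  proof (rule nn_integral_cong_AE)
    have "AE t in lborel. (\<integral>\<^sup>+x. ennreal (indicator {k..K} x * D x (2 + 2 * cos t)) \<partial>lborel)
        = ennreal (G K (2 + 2 * cos t) - G k (2 + 2 * cos t))"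
      by (rule AE_circle_generic) (rule D)
    then show "AE t in lborel. ennreal (indicator {0..2*pi} t * (G K (2 + 2 * cos t) - G k (2 + 2 * cos t)))
        = (\<integral>\<^sup>+x. ?f x t \<partial>lborel)"
      by eventually_elim (auto simp: indicator_def)
  qed
  also have "\<dots> = (\<integral>\<^sup>+x. (\<integral>\<^sup>+t. ?f x t \<partial>lborel) \<partial>lborel)"
    by (rule lborel_pair.Fubini'[OF meas])
  also have "\<dots> = ?R"
    by (rule nn_integral_cong) (auto simp: indicator_def)
  finally show ?thesis .
qed

lemma circle_increment_eq:
  assumes k: "4 \<le> k" "k \<le> K"
  shows "(LINT t|lborel. indicator {0..2*pi} t * P_mean K (2 + 2 * cos t)) - (LINT t|lborel. indicator {0..2*pi} t * P_mean k (2 + 2 * cos t))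
    = (LINT t|lborel. indicator {0..2*pi} t * Q_mean K (2 + 2 * cos t)) - (LINT t|lborel. indicator {0..2*pi} t * Q_mean k (2 + 2 * cos t))"
proof -
  have cos_meas [measurable]: "cos \<in> borel_measurable (borel :: real measure)"
    by (intro borel_measurable_continuous_onI continuous_intros)
  let ?P = "\<lambda>k t. indicator {0..2*pi} t * P_mean k (2 + 2 * cos t)"
  let ?Q = "\<lambda>k t. indicator {0..2*pi} t * Q_mean k (2 + 2 * cos t)"
  let ?dP = "\<lambda>t. indicator {0..2*pi} t * (P_mean K (2 + 2 * cos t) - P_mean k (2 + 2 * cos t))"
  let ?dQ = "\<lambda>t. indicator {0..2*pi} t * (Q_mean K (2 + 2 * cos t) - Q_mean k (2 + 2 * cos t))"
  have intP: "integrable lborel (?P k)" "integrable lborel (?P K)"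
    using mahler2_P_poly(2) k by auto
  have intQ: "integrable lborel (?Q k)" "integrable lborel (?Q K)"
    using mahler2_Q_poly(2) k by auto
  have dP: "?dP = (\<lambda>t. ?P K t - ?P k t)" and dQ: "?dQ = (\<lambda>t. ?Q K t - ?Q k t)"
    by (simp_all add: right_diff_distrib)
  have "(\<integral>\<^sup>+t. ennreal (?dP t) \<partial>lborel) =
      (\<integral>\<^sup>+x. indicator {k..K} x * (\<integral>\<^sup>+t. ennreal (indicator {0..2*pi} t * P_deriv x (2 + 2 * cos t)) \<partial>lborel) \<partial>lborel)"
    by (rule nn_integral_circle_increment) (measurable, rule nn_integral_P_deriv, use k in auto)
  also have "\<dots> = (\<integral>\<^sup>+x. indicator {k..K} x * (\<integral>\<^sup>+t. ennreal (indicator {0..2*pi} t * Q_deriv x (2 + 2 * cos t)) \<partial>lborel) \<partial>lborel)"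
  proof (rule nn_integral_cong_AE)
    \<comment> \<open>The derivative identity holds for parameters above 4 only; for
      \<open>k = 4\<close> the left endpoint is discarded.\<close>
    have "AE x in lborel. x \<notin> {4::real}"
      by (intro AE_not_in finite_imp_null_set_lborel) simp
    then show "AE x in lborel. indicator {k..K} x * (\<integral>\<^sup>+t. ennreal (indicator {0..2*pi} t * P_deriv x (2 + 2 * cos t)) \<partial>lborel)
        = indicator {k..K} x * (\<integral>\<^sup>+t. ennreal (indicator {0..2*pi} t * Q_deriv x (2 + 2 * cos t)) \<partial>lborel)"
    proof eventually_elim
      case (elim x)
      show ?case
      proof (cases "x \<in> {k..K}")
        case True
        then have "4 < x" using elim k by auto
        then show ?thesis by (simp only: nn_integral_circle_deriv_eq)
      qed simp
    qed
  qed
  also have "\<dots> = (\<integral>\<^sup>+t. ennreal (?dQ t) \<partial>lborel)"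
    by (rule nn_integral_circle_increment[symmetric]) (measurable, rule nn_integral_Q_deriv, use k in auto)
  finally have eq: "(\<integral>\<^sup>+t. ennreal (?dP t) \<partial>lborel) = (\<integral>\<^sup>+t. ennreal (?dQ t) \<partial>lborel)" .
  \<comment> \<open>The means increase in the parameter, so the equality of nonnegative integrals
    passes to the Bochner integrals.\<close>
  have P0: "AE t in lborel. 0 \<le> ?dP t"
  proof -
    have "AE t in lborel. P_mean k (2 + 2 * cos t) \<le> P_mean K (2 + 2 * cos t)"
      by (rule AE_circle_generic) (use P_mean_mono k in auto)
    then show ?thesis by eventually_elim simp
  qed
  have Q0: "AE t in lborel. 0 \<le> ?dQ t"
  proof -
    have "AE t in lborel. Q_mean k (2 + 2 * cos t) \<le> Q_mean K (2 + 2 * cos t)"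
      by (rule AE_circle_generic) (use Q_mean_mono k in auto)
    then show ?thesis by eventually_elim simp
  qed
  have "?dP \<in> borel_measurable lborel" "?dQ \<in> borel_measurable lborel"
    unfolding dP dQ using intP intQ by (auto intro: borel_measurable_integrable)
  then have "(LINT t|lborel. ?dP t) = (LINT t|lborel. ?dQ t)"
    using integral_eq_nn_integral[OF _ P0] integral_eq_nn_integral[OF _ Q0] eq by simp
  then show ?thesis
    unfolding dP dQ using intP intQ by simp
qed

section \<open>Growth as the parameter tends to infinity\<close>

lemma quadratic_mean_scale:
  assumes "0 < c" "0 \<le> a" "0 < max b (2 * a)"
  shows "quadratic_mean (c * a) (c * b) = ln c + quadratic_mean a b"
proof -
  define m where "m = max b (2 * a)"
  define s where "s = sqrt (m^2 - 4 * a^2)"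
  have m: "2 * a \<le> m" "0 < m" using assms by (auto simp: m_def)
  then have "(2 * a)^2 \<le> m^2" using assms by (intro power_mono) auto
  then have s: "0 \<le> s" by (simp add: s_def power_mult_distrib)
  have "max (c * b) (2 * (c * a)) = c * m"
    using assms(1) by (simp add: m_def max_mult_distrib_left mult.left_commute)
  moreover have "(c * m)^2 - 4 * (c * a)^2 = c^2 * (m^2 - 4 * a^2)"
    by (simp add: algebra_simps power_mult_distrib)
  then have "sqrt ((c * m)^2 - 4 * (c * a)^2) = c * s"
    using assms(1) by (simp add: real_sqrt_mult s_def)
  ultimately have "quadratic_mean (c * a) (c * b) = ln ((c * m + c * s) / 2)"
    by (simp add: quadratic_mean_def)
  also have "(c * m + c * s) / 2 = c * ((m + s) / 2)" by (simp add: algebra_simps)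
  also have "ln \<dots> = ln c + ln ((m + s) / 2)"
    using add_pos_nonneg[OF m(2) s] assms(1) by (subst ln_mult) auto
  finally show ?thesis by (simp add: quadratic_mean_def s_def m_def)
qed

text \<open>By homogeneity \<open>X\<close> can be divided out. Then \<open>a / X\<close> tends to
  0, and the mean is continuous at \<open>(0, \<beta>)\<close> with value
  \<open>ln \<beta>\<close>.\<close>

lemma quadratic_mean_asymptotic:
  assumes "0 \<le> a" "0 < \<beta>"
    and X: "filterlim X at_top sequentially" and b: "(\<lambda>n. b n / X n) \<longlonglongrightarrow> \<beta>"
  shows "(\<lambda>n. quadratic_mean a (b n) - ln (X n)) \<longlonglongrightarrow> ln \<beta>"
proof -
  have aX: "(\<lambda>n. a / X n) \<longlonglongrightarrow> 0" by (rule tendsto_divide_0[OF tendsto_const filterlim_at_top_imp_at_infinity[OF X]])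
  have "(\<lambda>n. quadratic_mean (a / X n) (b n / X n)) \<longlonglongrightarrow> quadratic_mean 0 \<beta>"
    unfolding quadratic_mean_def using assms(2)
    by (intro tendsto_intros aX b) (auto simp: max_def)
  also have "quadratic_mean 0 \<beta> = ln \<beta>" using assms(2) by (simp add: quadratic_mean_def)
  finally have "(\<lambda>n. quadratic_mean (a / X n) (b n / X n)) \<longlonglongrightarrow> ln \<beta>" .
  moreover have "eventually (\<lambda>n. quadratic_mean (a / X n) (b n / X n) = quadratic_mean a (b n) - ln (X n)) sequentially"
    using eventually_compose_filterlim[OF eventually_gt_at_top[of 0] X] order_tendstoD(1)[OF b assms(2)]
  proof eventually_elim
    case (elim n)
    have "quadratic_mean (X n * (a / X n)) (X n * (b n / X n)) = ln (X n) + quadratic_mean (a / X n) (b n / X n)"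
      using elim assms(1) by (intro quadratic_mean_scale) (auto simp: less_max_iff_disj)
    then show ?case using elim by simp
  qed
  ultimately show ?thesis by (rule Lim_transform_eventually)
qed

lemma abs_quadratic_mean_minus_ln_le:
  assumes "0 \<le> a" "0 < K" "0 < d" "K * d \<le> max b (2*a)" "max b (2*a) \<le> 8 * K"
  shows "\<bar>quadratic_mean a b - ln K\<bar> \<le> \<bar>ln d\<bar> + ln 8"
proof -
  have "0 < K * d" using assms by simp
  then have m: "0 < max b (2*a)" using assms by linarith
  have "ln K + ln d = ln (K * d)" using assms by (simp add: ln_mult)
  also have "\<dots> \<le> ln (max b (2*a))" using assms \<open>0 < K * d\<close> by (intro ln_mono)
  finally have "ln K + ln d - ln 2 \<le> quadratic_mean a b"
    using quadratic_mean_bounds(1)[OF assms(1) m] by linarith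
  moreover have "ln (max b (2*a)) \<le> ln (8 * K)" using assms m by (intro ln_mono) auto
  then have "quadratic_mean a b \<le> ln 8 + ln K"
    using quadratic_mean_bounds(2)[OF assms(1) m] assms(2) by (simp add: ln_mult)
  moreover have "ln 2 \<le> ln (8::real)" "0 \<le> ln (8::real)" by simp_all
  ultimately show ?thesis
    using abs_ge_self[of "ln d"] abs_ge_minus_self[of "ln d"] by (intro abs_leI) linarith+
qed

text \<open>On the circle \<open>2 + 2 * Re z = (cmod (z + 1))^2\<close>, so this is twice Jensen's
  formula at the boundary point \<open>-1\<close>.\<close>

lemma circle_integral_ln:
  "has_bochner_integral lborel (\<lambda>t. indicator {0..2*pi} t * ln (2 + 2 * cos t)) 0"
proof -
  have j: "has_circle_mean (\<lambda>z. ln (cmod (z - (-1)))) 0"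
    using circle_mean_jensen[of "-1"] by simp
  have "has_circle_mean (\<lambda>z. ln (2 + 2 * Re z)) 0"
  proof (rule has_circle_mean_cong[where X="{-1}"])
    show "has_circle_mean (\<lambda>z. ln (cmod (z - (-1))) + ln (cmod (z - (-1)))) 0"
      using has_circle_mean_add[OF j j] by simp
    fix z :: complex assume z: "cmod z = 1" "z \<notin> {-1}"
    have "Re z ^ 2 + Im z ^ 2 = 1" using z(1) by (simp add: cmod_def)
    then have "cmod (z - (-1)) ^ 2 = 2 + 2 * Re z"
      by (simp add: cmod_power2) (simp add: power2_eq_square algebra_simps)
    moreover have "0 < cmod (z - (-1))" using z(2) by (simp add: add_eq_0_iff2)
    then have "ln (cmod (z - (-1)) ^ 2) = ln (cmod (z - (-1))) + ln (cmod (z - (-1)))"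
      unfolding power2_eq_square by (subst ln_mult) auto
    ultimately show "ln (cmod (z - (-1))) + ln (cmod (z - (-1))) = ln (2 + 2 * Re z)" by simp
  qed simp
  then show ?thesis by (simp add: has_circle_mean_def)
qed

text \<open>The limit \<open>c * ln u\<close> integrates to 0 for every \<open>c\<close>. Hence both
  measures have the same expansion although \<open>c\<close> is \<open>1/2\<close> for
  \<open>P\<close> and \<open>1\<close> for \<open>Q\<close>.\<close>

lemma circle_integral_asymptotic:
  fixes G :: "real \<Rightarrow> real \<Rightarrow> real" and X :: "nat \<Rightarrow> real"
  assumes int: "\<And>n. integrable lborel (\<lambda>t. indicator {0..2*pi} t * G (X n) (2 + 2 * cos t))"
    and lim: "\<And>u. 0 < u \<Longrightarrow> (\<lambda>n. G (X n) u - ln (X n)) \<longlonglongrightarrow> c * ln u"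
    and bound: "\<And>n u. 0 < u \<Longrightarrow> u \<le> 4 \<Longrightarrow> \<bar>G (X n) u - ln (X n)\<bar> \<le> \<bar>ln u\<bar> + C"
  shows "(\<lambda>n. (LINT t|lborel. indicator {0..2*pi} t * G (X n) (2 + 2 * cos t)) - 2 * pi * ln (X n)) \<longlonglongrightarrow> 0"
proof -
  let ?g = "\<lambda>n t. indicator {0..2*pi} t * G (X n) (2 + 2 * cos t) - indicator {0..2*pi} t * ln (X n)"
  let ?l = "\<lambda>t. indicator {0..2*pi} t * ln (2 + 2 * cos t)"
  have l: "integrable lborel ?l" "(LINT t|lborel. ?l t) = 0"
    using circle_integral_ln by (auto simp: has_bochner_integral_iff)
  have "(\<lambda>n. LINT t|lborel. ?g n t) \<longlonglongrightarrow> (LINT t|lborel. c * ?l t)"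
  proof (rule integral_dominated_convergence)
    show "integrable lborel (\<lambda>t. \<bar>?l t\<bar> + indicator {0..2*pi} t * C)"
      using l(1) by (intro Bochner_Integration.integrable_add integrable_abs) simp_all
    show "(\<lambda>t. c * ?l t) \<in> borel_measurable lborel" using l(1) by auto
    show "?g n \<in> borel_measurable lborel" for n
      using int[of n] by (intro borel_measurable_diff) auto
    have "AE t in lborel. (\<lambda>n. G (X n) (2 + 2 * cos t) - ln (X n)) \<longlonglongrightarrow> c * ln (2 + 2 * cos t)"
      by (rule AE_circle_generic) (rule lim)
    then show "AE t in lborel. (\<lambda>n. ?g n t) \<longlonglongrightarrow> c * ?l t"
      by eventually_elim (auto simp: indicator_def)
    show "AE t in lborel. norm (?g n t) \<le> \<bar>?l t\<bar> + indicator {0..2*pi} t * C" for n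
    proof -
      have "AE t in lborel. \<bar>G (X n) (2 + 2 * cos t) - ln (X n)\<bar> \<le> \<bar>ln (2 + 2 * cos t)\<bar> + C"
        by (rule AE_circle_generic) (rule bound)
      then show ?thesis by eventually_elim (auto simp: indicator_def)
    qed
  qed
  moreover have "(LINT t|lborel. ?g n t) =
      (LINT t|lborel. indicator {0..2*pi} t * G (X n) (2 + 2 * cos t)) - 2 * pi * ln (X n)" for n
    using int[of n] by simp
  ultimately show ?thesis using l(2) by simp
qed

lemma P_mean_asymptotic:
  assumes X: "filterlim X at_top sequentially" and u: "0 < u"
  shows "(\<lambda>n. P_mean (X n) u - ln (X n)) \<longlonglongrightarrow> 1 / 2 * ln u"
proof -
  have "(\<lambda>n. P_mean (X n) u - ln (X n)) \<longlonglongrightarrow> ln (sqrt u)"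
    unfolding P_mean_def
  proof (rule quadratic_mean_asymptotic[OF _ _ X])
    show "(\<lambda>n. X n * sqrt u / X n) \<longlonglongrightarrow> sqrt u"
    proof (rule tendsto_eventually)
      show "eventually (\<lambda>n. X n * sqrt u / X n = sqrt u) sequentially"
        using eventually_compose_filterlim[OF eventually_gt_at_top[of 0] X]
        by eventually_elim simp
    qed
  qed (use u in auto)
  then show ?thesis using u by (simp add: ln_sqrt)
qed

lemma Q_mean_asymptotic:
  assumes X: "filterlim X at_top sequentially" and u: "0 < u"
  shows "(\<lambda>n. Q_mean (X n) u - ln (X n)) \<longlonglongrightarrow> 1 * ln u"
proof -
  have "(\<lambda>n. Q_mean (X n) u - ln (X n)) \<longlonglongrightarrow> ln u"
    unfolding Q_mean_def
  proof (rule quadratic_mean_asymptotic[OF _ u X])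
    have "(\<lambda>n. u + (u^2 - 2 * u - 2) / X n) \<longlonglongrightarrow> u + 0"
      by (intro tendsto_add tendsto_const tendsto_divide_0[OF tendsto_const filterlim_at_top_imp_at_infinity[OF X]])
    moreover have "eventually (\<lambda>n. u + (u^2 - 2 * u - 2) / X n = (u^2 + (X n - 2) * u - 2) / X n) sequentially"
      using eventually_compose_filterlim[OF eventually_gt_at_top[of 0] X]
      by eventually_elim (simp add: field_simps)
    ultimately show "(\<lambda>n. (u^2 + (X n - 2) * u - 2) / X n) \<longlonglongrightarrow> u"
      using Lim_transform_eventually by fastforce
  qed simp
  then show ?thesis by simp
qed

lemma P_mean_dominated:
  assumes K: "8 \<le> K" and u: "0 < u" "u \<le> 4"
  shows "\<bar>P_mean K u - ln K\<bar> \<le> \<bar>ln u\<bar> + (ln 8 + ln 4)"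
proof -
  have "max (K * sqrt u) (2 * \<bar>u - 1\<bar>) \<le> 8 * K"
    using P_max_le[of K u] K u by linarith
  then have "\<bar>P_mean K u - ln K\<bar> \<le> \<bar>ln (sqrt u)\<bar> + ln 8"
    unfolding P_mean_def using K u by (intro abs_quadratic_mean_minus_ln_le) auto
  moreover have "\<bar>ln (sqrt u)\<bar> \<le> \<bar>ln u\<bar>" using u by (simp add: ln_sqrt)
  moreover have "0 \<le> ln (4::real)" by simp
  ultimately show ?thesis by linarith
qed

lemma Q_mean_dominated:
  assumes K: "8 \<le> K" and u: "0 < u" "u \<le> 4"
  shows "\<bar>Q_mean K u - ln K\<bar> \<le> \<bar>ln u\<bar> + (ln 8 + ln 4)"
proof -
  let ?b = "u^2 + (K - 2) * u - 2"
  have le: "max ?b (2 * \<bar>u - 1\<bar>) \<le> 8 * K"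
    using Q_max_le[of K u] K u by linarith
  \<comment> \<open>The maximum is at least the average of \<open>?b\<close> and
    \<open>2 * (1 - u)\<close>, in which the constants cancel; \<open>K - 4 \<ge> K / 2\<close> then
    gives a lower bound linear in \<open>u\<close>. The factor \<open>1/4\<close> accounts for
    \<open>ln 4\<close> in the bound.\<close>
  have "K * (u / 4) \<le> (u^2 + (K - 4) * u) / 2"
  proof -
    have "0 \<le> u^2 + (K / 2 - 4) * u" using K u by simp
    then show ?thesis by (simp add: algebra_simps)
  qed
  also have "\<dots> \<le> max ?b (2 * \<bar>u - 1\<bar>)"
  proof -
    have "(b + 2 * (1 - u)) / 2 \<le> max b (2 * \<bar>u - 1\<bar>)" for b
      by (simp add: max_def abs_if)
    from this[of ?b] show ?thesis by (simp add: algebra_simps)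
  qed
  finally have "\<bar>Q_mean K u - ln K\<bar> \<le> \<bar>ln (u / 4)\<bar> + ln 8"
    unfolding Q_mean_def using K u le by (intro abs_quadratic_mean_minus_ln_le) auto
  moreover have "ln (u / 4) = ln u - ln 4" using u by (simp add: ln_div)
  moreover have "0 \<le> ln (4::real)" by simp
  ultimately show ?thesis by linarith
qed

theorem theorem1:
  fixes k :: real
  assumes "k \<ge> 4"
  shows "mahler2 (P_poly k) = mahler2 (Q_poly (k + 2))"
proof -
  define IP where "IP k = (LINT t|lborel. indicator {0..2*pi} t * P_mean k (2 + 2 * cos t))" for k
  define IQ where "IQ k = (LINT t|lborel. indicator {0..2*pi} t * Q_mean k (2 + 2 * cos t))" for k
  \<comment> \<open>The offset puts every \<open>X n\<close> above both 8, for domination, and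
    \<open>k\<close>, for the increment.\<close>
  define X where "X n = k + 8 + real n" for n
  have X: "8 \<le> X n" "k \<le> X n" "4 \<le> X n" for n using assms by (auto simp: X_def)
  have Xlim: "filterlim X at_top sequentially"
    unfolding X_def by (rule filterlim_tendsto_add_at_top[OF tendsto_const filterlim_real_sequentially])
  have "(\<lambda>n. IP (X n) - 2 * pi * ln (X n)) \<longlonglongrightarrow> 0"
    unfolding IP_def
    by (rule circle_integral_asymptotic[OF mahler2_P_poly(2)[OF X(3)] P_mean_asymptotic[OF Xlim] P_mean_dominated[OF X(1)]])
  moreover have "(\<lambda>n. IQ (X n) - 2 * pi * ln (X n)) \<longlonglongrightarrow> 0"
    unfolding IQ_def
    by (rule circle_integral_asymptotic[OF mahler2_Q_poly(2)[OF X(3)] Q_mean_asymptotic[OF Xlim] Q_mean_dominated[OF X(1)]])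
  ultimately have "(\<lambda>n. (IP (X n) - 2 * pi * ln (X n)) - (IQ (X n) - 2 * pi * ln (X n))) \<longlonglongrightarrow> 0 - 0"
    by (rule tendsto_diff)
  moreover have "(IP (X n) - 2 * pi * ln (X n)) - (IQ (X n) - 2 * pi * ln (X n)) = IP k - IQ k" for n
    using circle_increment_eq[OF assms X(2)[of n]] by (simp add: IP_def IQ_def)
  ultimately have "IP k - IQ k = 0" by (simp add: LIMSEQ_const_iff)
  then show ?thesis
    using mahler2_P_poly(1)[OF assms] mahler2_Q_poly(1)[OF assms] by (simp add: IP_def IQ_def)
qed

end
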